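(* There exists a compact symplectic $4$-manifold $(M,\omega)$ admitting two $\omega$-compatible almost complex structures $J_1$ and $J_2$ (i.e. defining almost Kähler structures with symplectic form $\omega$) such that $$h^1_{d+d^c}(J_1)\ne h^1_{d+d^c}(J_2).$$
   Context: An almost complex structure $J$ is $\omega$-compatible if $\omega(J\cdot,J\cdot)=\omega(\cdot,\cdot)$ and the symmetric tensor $\omega(J\cdot,\cdot)$ (up to the usual sign convention) is a Riemannian metric. $A^k$ is the space of smooth complex $k$-forms; $J$ acts on forms by $J\alpha=i^{p-q}\alpha$ for $\alpha\in A^{p,q}$; $d^c:=J^{-1}dJ$. On a compact almost complex manifold $(M,J)$, $h^1_{d+d^c}(J):=\dim_{\mathbb C}\{\alpha\in A^1:d\alpha=0,\ d^c\alpha=0\}$. *)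

theory Defs
  imports
    "HOL-Analysis.Analysis"
    "HOL-Combinatorics.Permutations"
    "HOL-Library.Extended_Nat"
    "HOL-Library.Function_Algebras"
begin

section \<open>Smooth manifolds\<close>

text \<open>
  \<open>S\<close> is always an open set below; then \<open>smooth_on S f\<close> says that \<open>f\<close> is of class
  \<open>C\<^sup>\<infinity>\<close> on \<open>S\<close>, i.e. that all iterated directional derivatives exist and are continuous.
\<close>

primrec differentiable_times ::
    "nat \<Rightarrow> 'e::euclidean_space set \<Rightarrow> ('e \<Rightarrow> 'b::real_normed_vector) \<Rightarrow> bool" where
  "differentiable_times 0 S f \<longleftrightarrow> continuous_on S f"
| "differentiable_times (Suc n) S f \<longleftrightarrow>
     (\<forall>x\<in>S. f differentiable (at x)) \<and>
     (\<forall>v. differentiable_times n S (\<lambda>x. frechet_derivative f (at x) v))"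

definition smooth_on :: "'e::euclidean_space set \<Rightarrow> ('e \<Rightarrow> 'b::real_normed_vector) \<Rightarrow> bool" where
  "smooth_on S f \<longleftrightarrow> (\<forall>n. differentiable_times n S f)"

text \<open>A chart is a pair of its domain and its coordinate map, which is only relevant on the domain.\<close>

type_synonym ('a, 'e) chart = "'a set \<times> ('a \<Rightarrow> 'e)"

definition coords :: "('a, 'e) chart \<Rightarrow> 'e set" where
  "coords c = snd c ` fst c"

definition overlap :: "('a, 'e) chart \<Rightarrow> ('a, 'e) chart \<Rightarrow> 'e set" where
  "overlap c c' = snd c ` (fst c \<inter> fst c')"

definition transition :: "('a, 'e) chart \<Rightarrow> ('a, 'e) chart \<Rightarrow> 'e \<Rightarrow> 'e" where
  "transition c c' = snd c' \<circ> inv_into (fst c) (snd c)"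

definition smooth_manifold ::
    "'a topology \<Rightarrow> ('a, 'e::euclidean_space) chart set \<Rightarrow> bool" where
  "smooth_manifold X A \<longleftrightarrow>
     Hausdorff_space X \<and> second_countable X \<and>
     (\<Union>c\<in>A. fst c) = topspace X \<and>
     (\<forall>c\<in>A. openin X (fst c) \<and> open (coords c) \<and>
        homeomorphic_map (subtopology X (fst c)) (top_of_set (coords c)) (snd c)) \<and>
     (\<forall>c\<in>A. \<forall>c'\<in>A. smooth_on (overlap c c') (transition c c'))"

section \<open>Tensor fields and differential forms\<close>

text \<open>
  Tensor fields are given by their local representatives: one for each chart of the atlas, defined
  on the coordinate image of the chart, which transform into each other under the changes of
  coordinates. Thus \<open>T c x [v\<^sub>1, \<dots>, v\<^sub>k]\<close> is the value, at the point with coordinates \<open>x\<close> in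
  the chart \<open>c\<close>, of the covariant \<open>k\<close>-tensor \<open>T\<close> on the tangent vectors with components
  \<open>v\<^sub>1, \<dots>, v\<^sub>k\<close>. Values at meaningless arguments are fixed to be 0, so that a tensor field is
  determined by its actual values and tensor fields form a vector space.
\<close>

type_synonym ('a, 'e, 'b) tensor = "('a, 'e) chart \<Rightarrow> 'e \<Rightarrow> 'e list \<Rightarrow> 'b"

definition tensor_field ::
    "('a, 'e::euclidean_space) chart set \<Rightarrow> nat \<Rightarrow> ('a, 'e, 'b::real_normed_vector) tensor \<Rightarrow> bool"
  where
  "tensor_field A k T \<longleftrightarrow>
     (\<forall>c x vs. \<not> (c \<in> A \<and> x \<in> coords c \<and> length vs = k) \<longrightarrow> T c x vs = 0) \<and>
     (\<forall>c\<in>A. \<forall>x\<in>coords c. \<forall>vs i. length vs = k \<and> i < k \<longrightarrow> linear (\<lambda>v. T c x (vs[i := v]))) \<and>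
     (\<forall>c\<in>A. \<forall>vs. smooth_on (coords c) (\<lambda>x. T c x vs)) \<and>
     (\<forall>c\<in>A. \<forall>c'\<in>A. \<forall>x\<in>overlap c c'. \<forall>vs.
        T c x vs =
        T c' (transition c c' x) (map (frechet_derivative (transition c c') (at x)) vs))"

definition alternating :: "nat \<Rightarrow> ('e list \<Rightarrow> 'b::zero) \<Rightarrow> bool" where
  "alternating k a \<longleftrightarrow>
     (\<forall>vs i j. length vs = k \<and> i < j \<and> j < k \<and> vs ! i = vs ! j \<longrightarrow> a vs = 0)"

definition forms ::
    "('a, 'e::euclidean_space) chart set \<Rightarrow> nat \<Rightarrow> ('a, 'e, 'b::real_normed_vector) tensor set" where
  "forms A k = {\<alpha>. tensor_field A k \<alpha> \<and> (\<forall>c x. alternating k (\<alpha> c x))}"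

abbreviation complex_forms ::
    "('a, 'e::euclidean_space) chart set \<Rightarrow> nat \<Rightarrow> ('a, 'e, complex) tensor set" where
  "complex_forms \<equiv> forms"

text \<open>
  In local coordinates
  \<open>d\<alpha>(v\<^sub>0, \<dots>, v\<^sub>k) = (\<Sum>i. (-1)\<^sup>i (\<partial>/\<partial>v\<^sub>i) \<alpha>(v\<^sub>0, \<dots>, v\<^sub>i omitted, \<dots>, v\<^sub>k))\<close>.
\<close>

definition ext_deriv ::
    "('a, 'e::euclidean_space) chart set \<Rightarrow> ('a, 'e, 'b::real_normed_vector) tensor \<Rightarrow>
     ('a, 'e, 'b) tensor" where
  "ext_deriv A \<alpha> = (\<lambda>c x vs.
     if c \<in> A \<and> x \<in> coords c
     then \<Sum>i<length vs. (-1) ^ i *\<^sub>R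
            frechet_derivative (\<lambda>y. \<alpha> c y (take i vs @ drop (Suc i) vs)) (at x) (vs ! i)
     else 0)"

section \<open>Almost complex structures and symplectic forms\<close>

text \<open>Endomorphisms of the tangent bundle are likewise given by local representatives.\<close>

type_synonym ('a, 'e) endo = "('a, 'e) chart \<Rightarrow> 'e \<Rightarrow> 'e \<Rightarrow> 'e"

definition almost_complex ::
    "('a, 'e::euclidean_space) chart set \<Rightarrow> ('a, 'e) endo \<Rightarrow> bool" where
  "almost_complex A J \<longleftrightarrow>
     (\<forall>c\<in>A. \<forall>x\<in>coords c. linear (J c x) \<and> (\<forall>v. J c x (J c x v) = - v)) \<and>
     (\<forall>c\<in>A. \<forall>v. smooth_on (coords c) (\<lambda>x. J c x v)) \<and>
     (\<forall>c\<in>A. \<forall>c'\<in>A. \<forall>x\<in>overlap c c'. \<forall>v.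
        frechet_derivative (transition c c') (at x) (J c x v) =
        J c' (transition c c' x) (frechet_derivative (transition c c') (at x) v))"

definition symplectic_form ::
    "('a, 'e::euclidean_space) chart set \<Rightarrow> ('a, 'e, real) tensor \<Rightarrow> bool" where
  "symplectic_form A \<omega> \<longleftrightarrow>
     \<omega> \<in> forms A 2 \<and> ext_deriv A \<omega> = (\<lambda>c x vs. 0) \<and>
     (\<forall>c\<in>A. \<forall>x\<in>coords c. \<forall>u. (\<forall>v. \<omega> c x [u, v] = 0) \<longrightarrow> u = 0)"

definition riemannian_metric ::
    "('a, 'e::euclidean_space) chart set \<Rightarrow> ('a, 'e, real) tensor \<Rightarrow> bool" where
  "riemannian_metric A g \<longleftrightarrow>
     tensor_field A 2 g \<and>
     (\<forall>c\<in>A. \<forall>x\<in>coords c. \<forall>u v. g c x [u, v] = g c x [v, u]) \<and>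
     (\<forall>c\<in>A. \<forall>x\<in>coords c. \<forall>u. u \<noteq> 0 \<longrightarrow> g c x [u, u] > 0)"

text \<open>
  Sign convention: the metric is \<open>\<omega>(\<cdot>, J\<cdot>)\<close>, which for an \<open>\<omega>\<close>-invariant \<open>J\<close> is
  \<open>-\<omega>(J\<cdot>, \<cdot>)\<close>.
\<close>

definition compatible ::
    "('a, 'e::euclidean_space) chart set \<Rightarrow> ('a, 'e, real) tensor \<Rightarrow> ('a, 'e) endo \<Rightarrow> bool" where
  "compatible A \<omega> J \<longleftrightarrow>
     almost_complex A J \<and>
     (\<forall>c\<in>A. \<forall>x\<in>coords c. \<forall>u v. \<omega> c x [J c x u, J c x v] = \<omega> c x [u, v]) \<and>
     riemannian_metric A
       (\<lambda>c x vs. if length vs = 2 then \<omega> c x [vs ! 0, J c x (vs ! 1)] else 0)"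

section \<open>The action of an almost complex structure on complex forms\<close>

text \<open>
  A complex \<open>k\<close>-covector on a real vector space is a complex-valued, real multilinear, alternating
  map. The wedge product of covectors is \<open>(a\<^sub>1 \<and> \<dots> \<and> a\<^sub>k)(v\<^sub>1, \<dots>, v\<^sub>k) = det (a\<^sub>i(v\<^sub>j))\<close>.
\<close>

definition complex_covectors :: "nat \<Rightarrow> ('e::real_vector list \<Rightarrow> complex) set" where
  "complex_covectors k = {a.
     (\<forall>vs. length vs \<noteq> k \<longrightarrow> a vs = 0) \<and>
     (\<forall>vs i. length vs = k \<and> i < k \<longrightarrow> linear (\<lambda>v. a (vs[i := v]))) \<and>
     alternating k a}"

definition wedge :: "('e \<Rightarrow> complex) list \<Rightarrow> 'e list \<Rightarrow> complex" where
  "wedge as vs =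
     (if length vs = length as
      then \<Sum>\<sigma> | \<sigma> permutes {..<length as}.
             of_int (sign \<sigma>) * (\<Prod>i<length as. (as ! \<sigma> i) (vs ! i))
      else 0)"

text \<open>\<open>\<Lambda>\<^sup>p\<^sup>,\<^sup>q\<close> of a real vector space with complex structure \<open>J\<close>: the complex span of the products
  of \<open>p\<close> covectors of type \<open>(1,0)\<close> and \<open>q\<close> covectors of type \<open>(0,1)\<close>.\<close>

definition bidegree ::
    "('e::real_vector \<Rightarrow> 'e) \<Rightarrow> nat \<Rightarrow> nat \<Rightarrow> ('e list \<Rightarrow> complex) set" where
  "bidegree J p q = module.span (\<lambda>s a vs. s * a vs)
     {wedge (as @ bs) | as bs.
        length as = p \<and> (\<forall>a\<in>set as. linear a \<and> (\<forall>v. a (J v) = \<i> * a v)) \<and>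
        length bs = q \<and> (\<forall>b\<in>set bs. linear b \<and> (\<forall>v. b (J v) = - \<i> * b v))}"

text \<open>
  The action on \<open>k\<close>-covectors: multiplication by \<open>\<i>\<^sup>p\<^sup>-\<^sup>q\<close> on \<open>\<Lambda>\<^sup>p\<^sup>,\<^sup>q\<close>, extended linearly to
  the direct sum of the \<open>\<Lambda>\<^sup>p\<^sup>,\<^sup>q\<close> with \<open>p + q = k\<close>.
\<close>

definition J_covector ::
    "('e::real_vector \<Rightarrow> 'e) \<Rightarrow> nat \<Rightarrow> ('e list \<Rightarrow> complex) \<Rightarrow> ('e list \<Rightarrow> complex)" where
  "J_covector J k a = (THE b. \<exists>c.
     (\<forall>p\<le>k. c p \<in> bidegree J p (k - p)) \<and>
     (\<forall>vs. a vs = (\<Sum>p\<le>k. c p vs)) \<and>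
     (\<forall>vs. b vs = (\<Sum>p\<le>k. \<i> powi (int p - int (k - p)) * c p vs)))"

definition J_covector_inv ::
    "('e::real_vector \<Rightarrow> 'e) \<Rightarrow> nat \<Rightarrow> ('e list \<Rightarrow> complex) \<Rightarrow> ('e list \<Rightarrow> complex)" where
  "J_covector_inv J k = inv_into (complex_covectors k) (J_covector J k)"

definition J_form ::
    "('a, 'e::euclidean_space) chart set \<Rightarrow> ('a, 'e) endo \<Rightarrow> nat \<Rightarrow>
     ('a, 'e, complex) tensor \<Rightarrow> ('a, 'e, complex) tensor" where
  "J_form A J k \<alpha> = (\<lambda>c x vs.
     if c \<in> A \<and> x \<in> coords c then J_covector (J c x) k (\<alpha> c x) vs else 0)"

definition J_form_inv ::
    "('a, 'e::euclidean_space) chart set \<Rightarrow> ('a, 'e) endo \<Rightarrow> nat \<Rightarrow>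
     ('a, 'e, complex) tensor \<Rightarrow> ('a, 'e, complex) tensor" where
  "J_form_inv A J k \<alpha> = (\<lambda>c x vs.
     if c \<in> A \<and> x \<in> coords c then J_covector_inv (J c x) k (\<alpha> c x) vs else 0)"

text \<open>\<open>d\<^sup>c = J\<^sup>-\<^sup>1 d J\<close> on forms of degree \<open>k\<close>.\<close>

definition dc ::
    "('a, 'e::euclidean_space) chart set \<Rightarrow> ('a, 'e) endo \<Rightarrow> nat \<Rightarrow>
     ('a, 'e, complex) tensor \<Rightarrow> ('a, 'e, complex) tensor" where
  "dc A J k \<alpha> = J_form_inv A J (Suc k) (ext_deriv A (J_form A J k \<alpha>))"

section \<open>The number $h^1_{d+d^c}$\<close>

definition scale_form :: "complex \<Rightarrow> ('a, 'e, complex) tensor \<Rightarrow> ('a, 'e, complex) tensor" where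
  "scale_form s \<alpha> = (\<lambda>c x vs. s * \<alpha> c x vs)"

lemma vector_space_scale_form: "vector_space scale_form"
  by unfold_locales (auto simp: scale_form_def fun_eq_iff algebra_simps)

text \<open>The library's \<open>dim\<close> does not distinguish infinite dimension from 0.\<close>

definition complex_dim :: "('a, 'e, complex) tensor set \<Rightarrow> enat" where
  "complex_dim V =
     (if \<exists>B. finite B \<and> V \<subseteq> module.span scale_form B
      then enat (vector_space.dim scale_form V) else \<infinity>)"

definition h1_d_dc :: "('a, 'e::euclidean_space) chart set \<Rightarrow> ('a, 'e) endo \<Rightarrow> enat" where
  "h1_d_dc A J = complex_dim
     {\<alpha> \<in> complex_forms A 1. ext_deriv A \<alpha> = (\<lambda>c x vs. 0) \<and> dc A J 1 \<alpha> = (\<lambda>c x vs. 0)}"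

text \<open>
  HOL cannot quantify existentially over the type of points of a manifold. Every
  second countable manifold has at most the cardinality of the continuum, hence is diffeomorphic
  to one whose underlying set is a subset of any given type of that cardinality; we use the
  following one. Its own topology plays no role: the topology of a manifold is part of the data.
\<close>

type_synonym point = "complex ^ 4"

end

theory Submission
  imports Defs "HOL-Complex_Analysis.Cauchy_Integral_Formula"
begin

text \<open>
  On the torus \<open>\<real>\<^sup>4 / (2\<pi>\<int>)\<^sup>4\<close> with \<open>\<omega> = dx\<^sub>1 \<and> dx\<^sub>2 + dx\<^sub>3 \<and> dx\<^sub>4\<close>, let \<open>J\<close> be standard on
  \<open>\<langle>\<partial>\<^sub>3, \<partial>\<^sub>4\<rangle>\<close> and \<open>J \<partial>\<^sub>1 = s \<partial>\<^sub>1 + (1 + s\<^sup>2) \<partial>\<^sub>2\<close>, \<open>J \<partial>\<^sub>2 = - \<partial>\<^sub>1 - s \<partial>\<^sub>2\<close> with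
  \<open>s = r sin x\<^sub>3\<close>. For \<open>r = 0\<close> all four \<open>dx\<^sub>i\<close> satisfy \<open>d\<alpha> = d\<^sup>c\<alpha> = 0\<close>. For \<open>r = 1\<close> let
  \<open>\<alpha> = \<Sum>a\<^sub>i dx\<^sub>i\<close> be such that \<open>\<alpha>\<close> and \<open>J\<alpha>\<close> are closed. On each plane parallel to
  \<open>\<langle>\<partial>\<^sub>1, \<partial>\<^sub>2\<rangle>\<close> or \<open>\<langle>\<partial>\<^sub>3, \<partial>\<^sub>4\<rangle>\<close> the structure \<open>J\<close> is constant in the directions of the plane, so
  that the (1,0) and (0,1) parts of \<open>\<alpha>\<close> along it have bounded holomorphic and antiholomorphic
  coefficients on \<open>\<complex>\<close>, which are constant by Liouville's theorem. Hence
  \<open>\<partial>\<^sub>j a\<^sub>i = \<partial>\<^sub>i a\<^sub>j\<close> is constant for \<open>i \<le> 2 < j\<close> and, the \<open>a\<^sub>i\<close> being bounded, zero; all \<open>a\<^sub>i\<close>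
  are constant, and closedness of \<open>J\<alpha>\<close> then forces \<open>a\<^sub>1 = a\<^sub>2 = 0\<close>. Thus \<open>h\<^sup>1\<close> is at least 4 for
  \<open>r = 0\<close> and at most 2 for \<open>r = 1\<close>.
\<close>

section \<open>Smoothness\<close>

lemma has_derivative_cong_open:
  assumes "open S" "x \<in> S" "\<And>y. y \<in> S \<Longrightarrow> f y = g y"
  shows "(f has_derivative f') (at x) \<longleftrightarrow> (g has_derivative f') (at x)"
  using assms has_derivative_transform_within_open[of f f' x UNIV S g]
    has_derivative_transform_within_open[of g f' x UNIV S f] by auto

lemma frechet_derivative_cong_open:
  assumes "open S" "x \<in> S" "\<And>y. y \<in> S \<Longrightarrow> f y = g y"
  shows "frechet_derivative f (at x) = frechet_derivative g (at x)"
  unfolding frechet_derivative_def using has_derivative_cong_open[OF assms] by simp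

lemma differentiable_cong_open:
  assumes "open S" "x \<in> S" "\<And>y. y \<in> S \<Longrightarrow> f y = g y"
  shows "f differentiable (at x) \<longleftrightarrow> g differentiable (at x)"
  unfolding differentiable_def using has_derivative_cong_open[OF assms] by simp

text \<open>Representatives and transition maps agree with convenient formulas only on an open chart
  domain. Functions agreeing there have equal derivatives there, which carries the
  induction.\<close>

lemma differentiable_times_cong:
  assumes "open S" "\<And>y. y \<in> S \<Longrightarrow> f y = g y"
  shows "differentiable_times n S f \<longleftrightarrow> differentiable_times n S g"
  using assms(2)
proof (induction n arbitrary: f g)
  case 0
  then show ?case by (auto intro: continuous_on_cong)
next
  case (Suc n)
  have "f differentiable (at x) \<longleftrightarrow> g differentiable (at x)" if "x \<in> S" for x
    by (rule differentiable_cong_open[OF assms(1) that Suc.prems])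
  moreover have "differentiable_times n S (\<lambda>x. frechet_derivative f (at x) v) \<longleftrightarrow>
      differentiable_times n S (\<lambda>x. frechet_derivative g (at x) v)" for v
    by (rule Suc.IH) (simp only: frechet_derivative_cong_open[OF assms(1) _ Suc.prems])
  ultimately show ?case by simp
qed

lemma smooth_on_cong:
  assumes "open S" "\<And>y. y \<in> S \<Longrightarrow> f y = g y"
  shows "smooth_on S f \<longleftrightarrow> smooth_on S g"
  unfolding smooth_on_def using differentiable_times_cong[OF assms] by simp

lemma smooth_on_imp_differentiable:
  assumes "smooth_on S f" "x \<in> S"
  shows "f differentiable (at x)"
  using assms(1) assms(2) unfolding smooth_on_def by (metis differentiable_times.simps(2))

text \<open>These functions are closed under directional derivatives, as
  \<open>cos' t = cos (t + pi / 2)\<close>.\<close>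

lemma differentiable_times_trigonometric:
  fixes K L M :: "'b::real_normed_vector" and S :: "(real ^ 'n) set"
  shows "differentiable_times n S
    (\<lambda>x. K + cos (x $ j + c) *\<^sub>R L + cos (2 * x $ j + d) *\<^sub>R M)"
proof (induction n arbitrary: K L M c d)
  case 0
  show ?case by (auto intro!: continuous_intros)
next
  case (Suc n)
  let ?f = "\<lambda>x :: real ^ 'n. K + cos (x $ j + c) *\<^sub>R L + cos (2 * x $ j + d) *\<^sub>R M"
  have der: "(?f has_derivative (\<lambda>v. cos (x $ j + (c + pi / 2)) *\<^sub>R (v $ j *\<^sub>R L) +
        cos (2 * x $ j + (d + pi / 2)) *\<^sub>R ((2 * v $ j) *\<^sub>R M))) (at x)" for x
  proof -
    have "cos (x $ j + (c + pi / 2)) = - sin (x $ j + c)"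
      "cos (2 * x $ j + (d + pi / 2)) = - sin (2 * x $ j + d)"
      using minus_sin_cos_eq[of "x $ j + c"] minus_sin_cos_eq[of "2 * x $ j + d"]
      by (simp_all add: add.assoc)
    moreover have "((\<lambda>x :: real ^ 'n. x $ j) has_derivative (\<lambda>v. v $ j)) (at x)"
      by (rule bounded_linear_imp_has_derivative[OF bounded_linear_vec_nth])
    ultimately show ?thesis
      by (auto intro!: derivative_eq_intros simp: algebra_simps)
  qed
  have "differentiable_times n S (\<lambda>x. frechet_derivative ?f (at x) v)" for v
    using Suc.IH[of 0 "c + pi / 2" "v $ j *\<^sub>R L" "d + pi / 2" "(2 * v $ j) *\<^sub>R M"]
    by (simp add: frechet_derivative_at[OF der, symmetric])
  moreover have "?f differentiable (at x)" for x
    using der differentiable_def by blast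
  ultimately show ?case by simp
qed

lemma smooth_on_const: "smooth_on (S :: (real ^ 'n) set) (\<lambda>x. K)"
  unfolding smooth_on_def
  using differentiable_times_trigonometric[of _ S K _ 0 0 _ 0] by simp

text \<open>The two frequencies are those of \<open>s = r * sin (x $ 3)\<close> and of its square,
  by sin^2 t = (1 - cos (2t)) / 2. All coefficients of the twisted structure and of its metric take
  this form.\<close>

lemma smooth_on_trigonometric:
  fixes K L M :: "'b::real_normed_vector" and S :: "(real ^ 'n) set"
  shows "smooth_on S (\<lambda>x. K + sin (x $ j) *\<^sub>R L + cos (2 * x $ j) *\<^sub>R M)"
proof -
  have "sin t = cos (t + - pi / 2)" for t :: real
    by (simp add: sin_cos_eq[of t] cos_minus[symmetric, of "pi / 2 - t"])
  then show ?thesis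
    unfolding smooth_on_def
    using differentiable_times_trigonometric[of _ S K j "- pi / 2" L 0 M] by simp
qed

text \<open>Meant for transition maps of the torus, which are only locally translations. Each first
  directional derivative is the constant \<open>v\<close>, so \<open>smooth_on_const\<close> covers
  the rest.\<close>

lemma smooth_on_translation:
  assumes "open (S :: (real ^ 'n) set)"
    and "\<And>x. x \<in> S \<Longrightarrow> (f has_derivative (\<lambda>v. v)) (at x)"
  shows "smooth_on S f"
  unfolding smooth_on_def
proof
  fix n
  have d: "f differentiable (at x)" if "x \<in> S" for x
    using assms(2)[OF that] differentiable_def by blast
  show "differentiable_times n S f"
  proof (cases n)
    case 0
    then show ?thesis
      using d by (auto intro!: continuous_at_imp_continuous_on differentiable_imp_continuous_within)
  next
    case (Suc m)
    have "differentiable_times m S (\<lambda>x. frechet_derivative f (at x) v)" for v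
    proof -
      have "differentiable_times m S (\<lambda>x. v)"
        using smooth_on_const[of S v] by (simp add: smooth_on_def)
      then show ?thesis
        by (subst differentiable_times_cong[OF assms(1), where g = "\<lambda>x. v"])
          (auto simp: frechet_derivative_at[OF assms(2), symmetric])
    qed
    with Suc d show ?thesis by simp
  qed
qed

section \<open>The torus\<close>

text \<open>The universal covering of the torus, the latter realised as a product of unit
  circles.\<close>

definition torus_map :: "real ^ 'n \<Rightarrow> complex ^ 'n" where
  "torus_map x = (\<chi> i. cis (x $ i))"

text \<open>A local inverse of \<open>torus_map\<close> with values near \<open>p\<close>. As 1 <
  \<open>pi\<close>, rotating \<open>w\<close> back by \<open>p\<close> keeps the argument of
  \<open>Arg\<close> off its branch cut.\<close>

definition torus_chart :: "real ^ 'n \<Rightarrow> (complex ^ 'n, real ^ 'n) chart" where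
  "torus_chart p = (torus_map ` ball p 1, \<lambda>w. \<chi> i. p $ i + Arg (w $ i * cis (- p $ i)))"

definition torus_atlas :: "(complex ^ 'n, real ^ 'n) chart set" where
  "torus_atlas = range torus_chart"

definition torus :: "(complex ^ 'n) topology" where
  "torus = top_of_set (range torus_map)"

text \<open>The difference \<open>y - x\<close> is a period of the covering, since
  \<open>cis\<close> is 1 at each of its components.\<close>

lemma torus_map_add:
  assumes "torus_map x = torus_map y"
  shows "torus_map (z + (y - x)) = torus_map z"
proof -
  have "cis (z $ i + (y $ i - x $ i)) = cis (z $ i)" for i
  proof -
    have "cis (x $ i) = cis (y $ i)"
      using assms by (simp add: torus_map_def vec_eq_iff)
    then have "cis (y $ i - x $ i) = 1"
      by (simp only: cis_divide[symmetric]) simp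
    then show ?thesis by (simp only: cis_mult[symmetric]) simp
  qed
  then show ?thesis by (simp add: torus_map_def vec_eq_iff)
qed

lemma torus_map_sin:
  assumes "torus_map x = torus_map y"
  shows "sin (x $ i) = sin (y $ i)"
  using assms by (simp_all add: torus_map_def vec_eq_iff complex_eq_iff)

lemma range_torus_map: "range (torus_map :: real ^ 'n \<Rightarrow> _) = {w. \<forall>i. norm (w $ i) = 1}"
proof -
  have "w \<in> range torus_map" if "\<forall>i. norm (w $ i) = 1" for w :: "complex ^ 'n"
  proof -
    have "cis (Arg (w $ i)) = w $ i" for i
      using that[rule_format, of i] cis_Arg[of "w $ i"] by (cases "w $ i = 0") (auto simp: sgn_eq)
    then have "torus_map (\<chi> i. Arg (w $ i)) = w"
      by (simp add: torus_map_def vec_eq_iff)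
    then show ?thesis by (metis rangeI)
  qed
  then show ?thesis by (auto simp: torus_map_def)
qed

lemma continuous_on_torus_map: "continuous_on S torus_map"
  unfolding torus_map_def by (intro continuous_intros)

text \<open>Each coordinate is reduced modulo 2 pi. The cube serves for compactness of the torus and
  for bounds on periodic functions.\<close>

lemma torus_map_reduce:
  "\<exists>y\<in>cbox 0 (\<chi> i. 2 * pi). torus_map y = torus_map x"
proof (intro bexI)
  let ?y = "\<chi> i. frac (x $ i / (2 * pi)) * (2 * pi)"
  have "0 \<le> frac t * (2 * pi)" "frac t * (2 * pi) \<le> 2 * pi" for t :: real
    using mult_right_mono[of "frac t" 1 "2 * pi"] frac_lt_1[of t] by simp_all
  then show "?y \<in> cbox 0 (\<chi> i. 2 * pi)" by (simp add: mem_box_cart)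
  have "frac (t / (2 * pi)) * (2 * pi) = t - 2 * pi * of_int \<lfloor>t / (2 * pi)\<rfloor>" for t
    by (simp add: frac_def left_diff_distrib)
  moreover have "cis (2 * pi * of_int k) = 1" for k
    by (rule cis_multiple_2pi) simp
  ultimately show "torus_map ?y = torus_map x"
    by (simp add: torus_map_def vec_eq_iff cis_divide[symmetric])
qed

lemma compact_range_torus_map: "compact (range (torus_map :: real ^ 'n \<Rightarrow> _))"
proof -
  have "range torus_map = torus_map ` cbox 0 (\<chi> i :: 'n. 2 * pi)"
  proof (intro equalityI subsetI)
    fix w :: "complex ^ 'n" assume "w \<in> range torus_map"
    then obtain x where "w = torus_map x" by auto
    with torus_map_reduce[of x] show "w \<in> torus_map ` cbox 0 (\<chi> i. 2 * pi)" by (metis imageI)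
  qed auto
  then show ?thesis
    using compact_continuous_image[OF continuous_on_torus_map compact_cbox] by simp
qed

lemma torus_chart_torus_map:
  assumes "x \<in> ball p 1"
  shows "snd (torus_chart p) (torus_map x) = x"
proof -
  have "Arg (cis (x $ i) * cis (- p $ i)) = x $ i - p $ i" for i
  proof -
    have "\<bar>x $ i - p $ i\<bar> < 1"
      using component_le_norm_cart[of "x - p" i] assms by (simp add: dist_norm norm_minus_commute)
    then have "x $ i - p $ i \<in> {-pi<..pi}" using pi_gt3 by auto
    then show ?thesis by (simp add: cis_mult Arg_cis)
  qed
  then show ?thesis by (simp add: torus_chart_def torus_map_def vec_eq_iff)
qed

lemma fst_torus_chart: "fst (torus_chart p) = torus_map ` ball p 1"
  by (simp add: torus_chart_def)

lemma coords_torus_chart: "coords (torus_chart p) = ball p 1"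
proof -
  have "coords (torus_chart p) = (\<lambda>x. x) ` ball p 1"
    unfolding coords_def fst_torus_chart image_image by (intro image_cong) (auto simp: torus_chart_torus_map)
  then show ?thesis by simp
qed

lemma overlap_torus_chart:
  "overlap (torus_chart p) (torus_chart q) = {x \<in> ball p 1. torus_map x \<in> torus_map ` ball q 1}"
proof -
  have "overlap (torus_chart p) (torus_chart q) =
      snd (torus_chart p) ` torus_map ` {x \<in> ball p 1. torus_map x \<in> torus_map ` ball q 1}"
    unfolding overlap_def fst_torus_chart by (rule arg_cong[of _ _ "image _"]) blast
  also have "\<dots> = (\<lambda>x. x) ` {x \<in> ball p 1. torus_map x \<in> torus_map ` ball q 1}"
    unfolding image_image by (intro image_cong) (auto simp: torus_chart_torus_map)
  finally show ?thesis by simp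
qed

lemma transition_torus_chart:
  assumes "x \<in> ball p 1" "y \<in> ball q 1" "torus_map x = torus_map y"
  shows "transition (torus_chart p) (torus_chart q) x = y"
proof -
  have "inv_into (torus_map ` ball p 1) (snd (torus_chart p)) x = torus_map x"
    using assms(1) by (intro inv_into_f_eq)
      (auto intro!: inj_onI simp: torus_chart_torus_map)
  then show ?thesis
    using assms by (simp add: transition_def fst_torus_chart torus_chart_torus_map)
qed

text \<open>Near \<open>x\<close> the transition is translation by the period \<open>y - x\<close>,
  as long as the translate stays in the second ball. Hence tangent vectors have the same components
  in all charts.\<close>

lemma has_derivative_transition_torus_chart:
  assumes "x \<in> overlap (torus_chart p) (torus_chart q)"
  shows "(transition (torus_chart p) (torus_chart q) has_derivative (\<lambda>v. v)) (at x)"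
proof -
  obtain y where x: "x \<in> ball p 1" and y: "y \<in> ball q 1" "torus_map x = torus_map y"
    using assms by (auto simp: overlap_torus_chart)
  let ?S = "ball p 1 \<inter> (\<lambda>z. z + (y - x)) -` ball q 1"
  have "open ?S"
    by (intro open_Int open_ball open_vimage) (auto intro!: continuous_intros)
  moreover have "x \<in> ?S" using x y by simp
  moreover have "z + (y - x) = transition (torus_chart p) (torus_chart q) z" if "z \<in> ?S" for z
    using that y(2) by (subst transition_torus_chart[where y = "z + (y - x)"])
      (simp_all add: torus_map_add)
  moreover have "((\<lambda>z. z + (y - x)) has_derivative (\<lambda>v. v)) (at x)"
    by (auto intro!: derivative_eq_intros)
  ultimately show ?thesis
    using has_derivative_cong_open[of ?S x "\<lambda>z. z + (y - x)"] by blast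
qed

text \<open>The formula of the chart is continuous on the open set \<open>?U\<close> that avoids the
  branch cut, and the image of \<open>V\<close> is the part of the torus in \<open>?U\<close> that
  this formula sends into \<open>V\<close>.\<close>

lemma open_map_torus_map:
  assumes "V \<subseteq> ball p 1" "open V"
  shows "openin torus (torus_map ` V)"
proof -
  let ?U = "{w. \<forall>i. w $ i * cis (- p $ i) \<in> - \<real>\<^sub>\<le>\<^sub>0}"
  let ?g = "snd (torus_chart p)"
  have U: "?U = (\<Inter>i. (\<lambda>w. w $ i * cis (- p $ i)) -` (- \<real>\<^sub>\<le>\<^sub>0))" by auto
  have "open ?U"
    unfolding U by (intro open_INT open_vimage open_Compl closed_nonpos_Reals_complex)
      (auto intro!: continuous_intros)
  moreover have "continuous_on ?U ?g"
    unfolding torus_chart_def by (auto intro!: continuous_intros)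
  ultimately have op: "open (?U \<inter> ?g -` V)"
    using assms(2) continuous_on_open_vimage[of ?U ?g] by (simp add: Int_commute)
  have "torus_map ` V = range torus_map \<inter> (?U \<inter> ?g -` V)"
  proof (intro equalityI subsetI)
    fix w assume "w \<in> torus_map ` V"
    then obtain x where x: "x \<in> V" "w = torus_map x" by auto
    have "cis (x $ i) * cis (- p $ i) \<notin> \<real>\<^sub>\<le>\<^sub>0" for i
    proof -
      have "\<bar>x $ i - p $ i\<bar> < 1"
        using component_le_norm_cart[of "x - p" i] x assms(1) 
        by (force simp: dist_norm norm_minus_commute)
      \<comment> \<open>An angle of size below 1 < pi / 2 has positive cosine, so the rotated point
        is off the negative real axis.\<close>
      then have "cos (x $ i - p $ i) > 0"
        using pi_gt3 by (intro cos_gt_zero_pi) auto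
      then show ?thesis by (auto simp: cis_mult complex_nonpos_Reals_iff)
    qed
    then show "w \<in> range torus_map \<inter> (?U \<inter> ?g -` V)"
      using x assms(1) by (auto simp: torus_chart_torus_map subset_iff) (simp add: torus_map_def)
  next
    fix w assume "w \<in> range torus_map \<inter> (?U \<inter> ?g -` V)"
    then have w: "w \<in> range torus_map" "?g w \<in> V" by auto
    have "torus_map (?g w) $ i = w $ i" for i
    proof -
      have 1: "norm (w $ i * cis (- p $ i)) = 1"
        using w(1) by (simp add: range_torus_map norm_mult)
      then have "w $ i * cis (- p $ i) \<noteq> 0" by (metis norm_zero zero_neq_one)
      then have "cis (Arg (w $ i * cis (- p $ i))) = w $ i * cis (- p $ i)"
        using 1 by (simp add: cis_Arg sgn_eq)
      then have "cis (p $ i + Arg (w $ i * cis (- p $ i))) = cis (p $ i) * (w $ i * cis (- p $ i))"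
        by (simp flip: cis_mult)
      also have "\<dots> = w $ i * (cis (p $ i) * cis (- p $ i))"
        by simp
      finally show ?thesis
        by (simp add: torus_map_def torus_chart_def cis_mult)
    qed
    then have "torus_map (?g w) = w" by (simp add: vec_eq_iff)
    then show "w \<in> torus_map ` V" using w(2) by (metis imageI)
  qed
  then show ?thesis
    unfolding torus_def openin_open using op by blast
qed

lemma smooth_manifold_torus:
  "smooth_manifold (torus :: (complex ^ 'n) topology) torus_atlas"
  unfolding smooth_manifold_def
proof (intro conjI ballI)
  show "Hausdorff_space (torus :: (complex ^ 'n) topology)"
    unfolding torus_def by (simp add: Hausdorff_space_subtopology)
  have "second_countable (euclidean :: (complex ^ 'n) topology)"
  proof -
    obtain B :: "(complex ^ 'n) set set" where B: "countable B" "\<And>C. C \<in> B \<Longrightarrow> open C"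
      "\<And>S. open S \<Longrightarrow> \<exists>U. U \<subseteq> B \<and> S = \<Union>U"
      by (metis univ_second_countable)
    have "\<exists>V\<in>B. x \<in> V \<and> V \<subseteq> U" if "open U" "x \<in> U" for U x
      using B(3)[OF that(1)] that(2) by blast
    with B(1,2) show ?thesis
      unfolding second_countable_def open_openin[symmetric] by blast
  qed
  then show "second_countable (torus :: (complex ^ 'n) topology)"
    unfolding torus_def by (rule second_countable_subtopology)
  show "(\<Union>c\<in>torus_atlas. fst c) = topspace (torus :: (complex ^ 'n) topology)"
    unfolding torus_atlas_def torus_def by (auto simp: fst_torus_chart)
next
  fix c :: "(complex ^ 'n, real ^ 'n) chart" assume "c \<in> torus_atlas"
  then obtain p where c: "c = torus_chart p" by (auto simp: torus_atlas_def)
  show op: "openin torus (fst c)"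
    unfolding c fst_torus_chart by (intro open_map_torus_map) auto
  show "open (coords c)" by (simp add: c coords_torus_chart)
  have "homeomorphic_maps (top_of_set (ball p 1)) (subtopology torus (fst c)) torus_map (snd c)"
    unfolding homeomorphic_maps_def
  proof (intro conjI ballI)
    have sub: "subtopology torus (fst c) = top_of_set (torus_map ` ball p 1)"
      by (auto simp: torus_def c fst_torus_chart subtopology_subtopology intro: arg_cong)
    show "continuous_map (top_of_set (ball p 1)) (subtopology torus (fst c)) torus_map"
      unfolding sub by (auto simp: continuous_on_torus_map)
    \<comment> \<open>The chart inverts \<open>torus_map\<close> on the ball, so its continuity is
      the openness of \<open>torus_map\<close>.\<close>
    have "continuous_on (torus_map ` ball p 1) (snd c)"
    proof (rule continuous_on_inverse_open_map)
      show "openin (top_of_set (torus_map ` ball p 1)) (torus_map ` U)"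
        if "openin (top_of_set (ball p 1)) U" for U
      proof -
        have "openin torus (torus_map ` U)"
          using that by (intro open_map_torus_map) (auto simp: openin_open)
        moreover have "torus_map ` U \<subseteq> torus_map ` ball p 1"
          using openin_subset[OF that] by auto
        ultimately show ?thesis
          unfolding sub[symmetric] openin_subtopology c fst_torus_chart by auto
      qed
    qed (auto simp: c continuous_on_torus_map torus_chart_torus_map)
    then show "continuous_map (subtopology torus (fst c)) (top_of_set (ball p 1)) (snd c)"
      unfolding sub by (auto simp: c torus_chart_torus_map)
  qed (auto simp: c torus_chart_torus_map fst_torus_chart torus_def)
  then show "homeomorphic_map (subtopology torus (fst c)) (top_of_set (coords c)) (snd c)"
    unfolding c coords_torus_chart by (metis homeomorphic_maps_map)
next
  fix c d :: "(complex ^ 'n, real ^ 'n) chart" assume "c \<in> torus_atlas" "d \<in> torus_atlas"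
  then obtain p q where c: "c = torus_chart p" "d = torus_chart q" by (auto simp: torus_atlas_def)
  have "open (overlap c d)"
  proof -
    have "openin torus (torus_map ` ball q 1)" by (intro open_map_torus_map) auto
    then obtain T where T: "open T" "torus_map ` ball q 1 = range torus_map \<inter> T"
      unfolding torus_def openin_open by blast
    have "overlap c d = ball p 1 \<inter> torus_map -` T"
      unfolding c overlap_torus_chart T(2) by auto
    then show ?thesis
      using T(1) by (simp add: open_Int open_vimage continuous_on_torus_map)
  qed
  then show "smooth_on (overlap c d) (transition c d)"
    unfolding c by (rule smooth_on_translation[OF _ has_derivative_transition_torus_chart])
qed

lemma compact_space_torus: "compact_space torus"
  unfolding torus_def by (simp add: compact_space_subtopology compactin_euclidean_iff compact_range_torus_map)

section \<open>The action of a complex structure on covectors\<close>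

lemma vector_space_covectors: "vector_space (\<lambda>s (a :: 'e list \<Rightarrow> complex) vs. s * a vs)"
  by unfold_locales (auto simp: fun_eq_iff algebra_simps)

lemma sum_fun_apply: "(\<Sum>i\<in>S. F i) x = (\<Sum>i\<in>S. F i x)"
  by (induction S rule: infinite_finite_induct) auto

text \<open>Every factor contributes its eigenvalue \<open>e j\<close>. A permutation only reorders
  these eigenvalues, so each term of the determinant acquires the same product.\<close>

lemma wedge_map:
  assumes "\<And>a v. a \<in> set as \<Longrightarrow> a (J v) = \<i> * a v"
    and "\<And>b v. b \<in> set bs \<Longrightarrow> b (J v) = - \<i> * b v"
  shows "wedge (as @ bs) (map J vs) = \<i> ^ length as * (- \<i>) ^ length bs * wedge (as @ bs) vs"
proof (cases "length vs = length as + length bs")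
  case True
  define p n where "p = length as" and "n = length as + length bs"
  define e where "e j = (if j < p then \<i> else - \<i>)" for j
  have e: "((as @ bs) ! j) (J v) = e j * ((as @ bs) ! j) v" if "j < n" for j v
    using that assms by (auto simp: e_def p_def n_def nth_append)
  have prod_e: "(\<Prod>j<n. e j) = \<i> ^ length as * (- \<i>) ^ length bs"
  proof -
    have "{..<n} \<inter> {j. j < p} = {..<p}" "{..<n} \<inter> - {j. j < p} = {p..<n}"
      by (auto simp: n_def p_def)
    then show ?thesis
      unfolding e_def by (simp add: prod.If_cases n_def p_def)
  qed
  have "(\<Prod>i<n. ((as @ bs) ! \<sigma> i) (map J vs ! i)) =
      \<i> ^ length as * (- \<i>) ^ length bs * (\<Prod>i<n. ((as @ bs) ! \<sigma> i) (vs ! i))"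
    if "\<sigma> permutes {..<n}" for \<sigma>
  proof -
    have "\<sigma> i < n" if "i < n" for i
      using permutes_in_image[OF \<open>\<sigma> permutes {..<n}\<close>, of i] that by simp
    then have "(\<Prod>i<n. ((as @ bs) ! \<sigma> i) (map J vs ! i)) =
        (\<Prod>i<n. e (\<sigma> i) * ((as @ bs) ! \<sigma> i) (vs ! i))"
      using True by (intro prod.cong) (auto simp: e n_def)
    also have "\<dots> = (\<Prod>i<n. e (\<sigma> i)) * (\<Prod>i<n. ((as @ bs) ! \<sigma> i) (vs ! i))"
      by (rule prod.distrib)
    also have "(\<Prod>i<n. e (\<sigma> i)) = (\<Prod>i<n. e i)"
      using prod.permute[OF that, of e] by (simp add: comp_def)
    finally show ?thesis by (simp add: prod_e)
  qed
  then show ?thesis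
    using True unfolding wedge_def n_def
    by (simp add: sum_distrib_left mult.left_commute)
next
  case False
  then show ?thesis by (simp add: wedge_def)
qed

text \<open>Both sides are linear in \<open>c\<close>, so generators suffice. This turns
  multiplication by \<i> to the power p - q into precomposition with \<open>J\<close>.\<close>

lemma bidegree_map:
  assumes "c \<in> bidegree J p q"
  shows "c (map J vs) = \<i> powi (int p - int q) * c vs"
proof -
  interpret vector_space "\<lambda>s (a :: 'a list \<Rightarrow> complex) vs. s * a vs"
    by (rule vector_space_covectors)
  have i: "\<i> ^ p * (- \<i>) ^ q = \<i> powi (int p - int q)"
  proof -
    have "(- \<i>) ^ q = inverse (\<i> ^ q)"
      by (simp flip: power_inverse)
    then show ?thesis
      using power_int_diff[of "\<i>" "int p" "int q"] by (simp add: divide_inverse)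
  qed
  from assms show ?thesis
    unfolding bidegree_def
  proof (induction rule: span_induct_alt)
    case base
    then show ?case by simp
  next
    case (step s x y)
    then show ?case
      by (auto simp: wedge_map i[symmetric] algebra_simps)
  qed
qed

text \<open>By \<open>bidegree_map\<close> every decomposition of \<open>a\<close> into types yields
  the same value, precomposition with \<open>J\<close>; this settles uniqueness in the definite
  description. Existence is the given decomposition.\<close>

lemma J_covector_eq:
  assumes "\<And>p. p \<le> k \<Longrightarrow> c p \<in> bidegree J p (k - p)"
    and "\<And>vs. a vs = (\<Sum>p\<le>k. c p vs)"
  shows "J_covector J k a = (\<lambda>vs. a (map J vs))"
proof -
  have *: "(\<Sum>p\<le>k. \<i> powi (int p - int (k - p)) * c p vs) = a (map J vs)"
    if "\<And>p. p \<le> k \<Longrightarrow> c p \<in> bidegree J p (k - p)" "\<And>vs. a vs = (\<Sum>p\<le>k. c p vs)" for c vs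
    unfolding that(2) by (intro sum.cong) (auto simp: bidegree_map[OF that(1)])
  show ?thesis
    unfolding J_covector_def
  proof (rule the_equality)
    show "\<exists>c. (\<forall>p\<le>k. c p \<in> bidegree J p (k - p)) \<and> (\<forall>vs. a vs = (\<Sum>p\<le>k. c p vs)) \<and>
        (\<forall>vs. a (map J vs) = (\<Sum>p\<le>k. \<i> powi (int p - int (k - p)) * c p vs))"
      using assms *[of c] by (intro exI[of _ c]) auto
  next
    fix b
    assume "\<exists>c. (\<forall>p\<le>k. c p \<in> bidegree J p (k - p)) \<and> (\<forall>vs. a vs = (\<Sum>p\<le>k. c p vs)) \<and>
        (\<forall>vs. b vs = (\<Sum>p\<le>k. \<i> powi (int p - int (k - p)) * c p vs))"
    then obtain c where c: "\<And>p. p \<le> k \<Longrightarrow> c p \<in> bidegree J p (k - p)"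
      "\<And>vs. a vs = (\<Sum>p\<le>k. c p vs)" "\<And>vs. b vs = (\<Sum>p\<le>k. \<i> powi (int p - int (k - p)) * c p vs)"
      by blast
    show "b = (\<lambda>vs. a (map J vs))"
      unfolding fun_eq_iff c(3) using *[OF c(1,2)] by simp
  qed
qed

section \<open>Decomposition of covectors of degree 1 and 2 into types\<close>

lemma wedge_1: "wedge [f] [v] = f v"
proof -
  have "{\<sigma>. \<sigma> permutes {..<Suc 0}} = {id}"
    by (auto simp: lessThan_Suc permutes_sing)
  then show ?thesis by (simp add: wedge_def)
qed

lemma wedge_2: "wedge [f, g] [v, w] = f v * g w - g v * f w"
proof -
  have two: "{..<2 :: nat} = {0, 1}" by auto
  have "{\<sigma>. \<sigma> permutes {..<2 :: nat}} = {id, Transposition.transpose 0 1}"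
    unfolding two permutes_doubleton_iff by auto
  moreover have "id \<noteq> Transposition.transpose 0 (1 :: nat)"
    by (metis id_apply transpose_apply_first zero_neq_one)
  ultimately show ?thesis
    by (simp add: wedge_def numeral_2_eq_2 sign_swap_id mult.commute)
qed

lemma wedge_length: "length vs \<noteq> length as \<Longrightarrow> wedge as vs = 0"
  by (simp add: wedge_def)

text \<open>The projection of a covector onto its (1,0) part, the \<i>-eigenspace of precomposition
  with \<open>J\<close>; \<open>type_01\<close> is the complementary projection.\<close>

definition type_10 :: "('e \<Rightarrow> 'e) \<Rightarrow> ('e \<Rightarrow> complex) \<Rightarrow> 'e \<Rightarrow> complex" where
  "type_10 J f v = (f v - \<i> * f (J v)) / 2"

definition type_01 :: "('e \<Rightarrow> 'e) \<Rightarrow> ('e \<Rightarrow> complex) \<Rightarrow> 'e \<Rightarrow> complex" where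
  "type_01 J f v = (f v + \<i> * f (J v)) / 2"

context
  fixes J :: "'e::euclidean_space \<Rightarrow> 'e"
  assumes linear_J: "linear J" and J_J: "\<And>v. J (J v) = - v"
begin

lemma linear_types:
  assumes "linear f"
  shows "linear (type_10 J f)" "linear (type_01 J f)"
proof -
  have "linear (\<lambda>v. f (J v))"
    using linear_compose[OF linear_J assms] by (simp add: comp_def)
  then show "linear (type_10 J f)" "linear (type_01 J f)"
    using assms unfolding type_10_def type_01_def linear_iff
    by (auto simp: algebra_simps add_divide_distrib diff_divide_distrib scaleR_conv_of_real)
qed

lemma types_J:
  assumes "linear f"
  shows "type_10 J f (J v) = \<i> * type_10 J f v" "type_01 J f (J v) = - \<i> * type_01 J f v"
  using linear_neg[OF assms] by (simp_all add: type_10_def type_01_def J_J field_simps)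

lemma types_add: "type_10 J f v + type_01 J f v = f v"
  by (simp add: type_10_def type_01_def field_simps)

lemma wedge_in_bidegree:
  assumes "\<And>f. f \<in> set fs \<Longrightarrow> linear f" "\<And>g. g \<in> set gs \<Longrightarrow> linear g"
  shows "wedge (map (type_10 J) fs @ map (type_01 J) gs) \<in> bidegree J (length fs) (length gs)"
proof -
  interpret vector_space "\<lambda>s (a :: 'e list \<Rightarrow> complex) vs. s * a vs"
    by (rule vector_space_covectors)
  show ?thesis
    unfolding bidegree_def
    by (rule span_base, rule CollectI, intro exI[of _ "map (type_10 J) fs"] exI[of _ "map (type_01 J) gs"])
      (auto simp: assms linear_types types_J)
qed

text \<open>The decomposition required by \<open>J_covector_eq\<close> is the one into
  \<open>type_01\<close> for p = 0 and \<open>type_10\<close> for p = 1.\<close>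

lemma J_covector_1:
  assumes "a \<in> complex_covectors 1"
  shows "J_covector J 1 a = (\<lambda>vs. a (map J vs))"
proof (rule J_covector_eq)
  let ?f = "\<lambda>v. a [v]"
  let ?c = "\<lambda>p :: nat. if p = 0 then wedge [type_01 J ?f] else wedge [type_10 J ?f]"
  have "\<forall>vs i. length vs = 1 \<and> i < 1 \<longrightarrow> linear (\<lambda>v. a (vs[i := v]))"
    using assms by (simp add: complex_covectors_def)
  from this[rule_format, of "[0]" 0] have lin: "linear ?f" by simp
  show "?c p \<in> bidegree J p (1 - p)" if "p \<le> 1" for p
  proof (cases "p = 0")
    case True
    then show ?thesis using wedge_in_bidegree[of "[]" "[?f]"] lin by simp
  next
    case False
    then have "p = 1" using that by simp
    then show ?thesis using wedge_in_bidegree[of "[?f]" "[]"] lin by simp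
  qed
  show "a vs = (\<Sum>p\<le>1. ?c p vs)" for vs
  proof (cases "length vs = 1")
    case True
    then obtain v where "vs = [v]" by (auto simp: length_Suc_conv)
    then show ?thesis using types_add[of ?f v] by (simp add: wedge_1 add.commute)
  next
    case False
    then show ?thesis using assms by (simp add: complex_covectors_def wedge_length)
  qed
qed

end

lemma covector_2_linear:
  assumes "a \<in> complex_covectors 2"
  shows "linear (\<lambda>v. a [v, w])" "linear (\<lambda>w. a [v, w])"
proof -
  have "\<forall>vs i. length vs = 2 \<and> i < 2 \<longrightarrow> linear (\<lambda>v. a (vs[i := v]))"
    using assms by (simp add: complex_covectors_def)
  from this[rule_format, of "[v, w]" 0] this[rule_format, of "[v, w]" 1]
  show "linear (\<lambda>v. a [v, w])" "linear (\<lambda>w. a [v, w])" by simp_all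
qed

lemma covector_2_same:
  assumes "a \<in> complex_covectors 2"
  shows "a [v, v] = 0"
proof -
  have "alternating 2 a" using assms by (simp add: complex_covectors_def)
  then show ?thesis unfolding alternating_def
    by (elim allE[of _ "[v, v]"] allE[of _ 0] allE[of _ 1]) simp
qed

lemma covector_2_swap:
  assumes "a \<in> complex_covectors 2"
  shows "a [w, v] = - a [v, w]"
proof -
  have "a [v + w, v + w] = a [v, v] + a [v, w] + (a [w, v] + a [w, w])"
    using linear_add[OF covector_2_linear(1)[OF assms, of "v + w"], of v w]
      linear_add[OF covector_2_linear(2)[OF assms]] by simp
  then show ?thesis
    by (simp add: covector_2_same[OF assms] add_eq_0_iff)
qed

lemma complex_covectors_2I:
  assumes "\<And>vs. length vs \<noteq> 2 \<Longrightarrow> a vs = 0"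
    and "\<And>w. linear (\<lambda>v. a [v, w])" "\<And>v. linear (\<lambda>w. a [v, w])" "\<And>v. a [v, v] = 0"
  shows "a \<in> complex_covectors 2"
proof -
  have "linear (\<lambda>v. a (vs[i := v]))" if "length vs = 2" "i < 2" for vs i
  proof -
    have "\<exists>x y. vs = [x, y]" using that(1) by (auto simp: length_Suc_conv numeral_2_eq_2)
    moreover have "i = 0 \<or> i = 1" using that(2) by auto
    ultimately show ?thesis using assms(2,3) by auto
  qed
  moreover have "a vs = 0" if "length vs = 2" "i < j" "j < 2" "vs ! i = vs ! j" for vs i j
  proof -
    have "\<exists>x y. vs = [x, y]" using that(1) by (auto simp: length_Suc_conv numeral_2_eq_2)
    moreover have "i = 0" "j = 1" using that(2,3) by auto
    ultimately show ?thesis using assms(4) that(4) by auto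
  qed
  ultimately show ?thesis
    using assms(1) unfolding complex_covectors_def alternating_def by blast
qed

text \<open>The factor \<open>1/2\<close> avoids choosing an order on the basis.\<close>

lemma covector_2_expand:
  fixes a :: "'e::euclidean_space list \<Rightarrow> complex"
  assumes "a \<in> complex_covectors 2"
  shows "a vs = (\<Sum>(i, j)\<in>Basis \<times> Basis.
    a [i, j] / 2 * wedge [\<lambda>v. of_real (v \<bullet> i), \<lambda>v. of_real (v \<bullet> j)] vs)"
proof (cases "length vs = 2")
  case True
  then obtain v w where vs: "vs = [v, w]" by (auto simp: length_Suc_conv numeral_2_eq_2)
  have e: "a [v, w] = (\<Sum>i\<in>Basis. \<Sum>j\<in>Basis. of_real (v \<bullet> i) * of_real (w \<bullet> j) * a [i, j])" for v w
  proof -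
    have "a [v, w] = a [\<Sum>i\<in>Basis. (v \<bullet> i) *\<^sub>R i, w]" by (simp add: euclidean_representation)
    also have "\<dots> = (\<Sum>i\<in>Basis. of_real (v \<bullet> i) * a [i, w])"
      unfolding linear_sum[OF covector_2_linear(1)[OF assms]] linear_scale[OF covector_2_linear(1)[OF assms]]
      by (simp add: scaleR_conv_of_real)
    also have "\<dots> = (\<Sum>i\<in>Basis. of_real (v \<bullet> i) * a [i, \<Sum>j\<in>Basis. (w \<bullet> j) *\<^sub>R j])"
      by (simp add: euclidean_representation)
    also have "\<dots> = (\<Sum>i\<in>Basis. of_real (v \<bullet> i) * (\<Sum>j\<in>Basis. of_real (w \<bullet> j) * a [i, j]))"
      unfolding linear_sum[OF covector_2_linear(2)[OF assms]] linear_scale[OF covector_2_linear(2)[OF assms]]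
      by (simp add: scaleR_conv_of_real)
    finally show ?thesis by (simp add: sum_distrib_left mult.assoc)
  qed
  have "(\<Sum>i\<in>Basis. \<Sum>j\<in>Basis. a [i, j] / 2 *
      (of_real (v \<bullet> i) * of_real (w \<bullet> j) - of_real (v \<bullet> j) * of_real (w \<bullet> i))) =
    (a [v, w] - a [w, v]) / 2"
    unfolding e[of v w] e[of w v] sum_subtractf[symmetric] sum_divide_distrib
    by (intro sum.cong refl) (simp add: field_simps)
  also have "\<dots> = a [v, w]" by (simp add: covector_2_swap[OF assms, of v w])
  finally show ?thesis by (simp add: vs wedge_2 sum.cartesian_product)
next
  case False
  then show ?thesis using assms by (simp add: complex_covectors_def wedge_length split_def)
qed

context
  fixes J :: "'e::euclidean_space \<Rightarrow> 'e"
  assumes linear_J: "linear J" and J_J: "\<And>v. J (J v) = - v"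
begin

text \<open>Each product of coordinate covectors in \<open>covector_2_expand\<close> is split by
  writing both factors as sums of their (1,0) and (0,1) parts; \<open>t\<close> collects the result
  by bidegree.\<close>

lemma J_covector_2:
  assumes "a \<in> complex_covectors 2"
  shows "J_covector J 2 a = (\<lambda>vs. a (map J vs))"
proof (rule J_covector_eq)
  interpret vector_space "\<lambda>s (a :: 'e list \<Rightarrow> complex) vs. s * a vs"
    by (rule vector_space_covectors)
  let ?P = "\<lambda>i :: 'e. type_10 J (\<lambda>v. of_real (v \<bullet> i))"
  let ?Q = "\<lambda>i :: 'e. type_01 J (\<lambda>v. of_real (v \<bullet> i))"
  \<comment> \<open>Generators of \<open>bidegree\<close> list (1,0) factors first. For p = 1 the
    product of the (0,1) part of the first factor with the (1,0) part of the second is therefore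
    swapped, whence the coefficient - 1.\<close>
  define t where "t p i j = (if p = (0 :: nat) then wedge [?Q i, ?Q j] else if p = 1 then
      (\<lambda>vs. wedge [?P i, ?Q j] vs + - 1 * wedge [?P j, ?Q i] vs) else wedge [?P i, ?P j])" for p i j
  let ?c = "\<lambda>p. \<Sum>(i, j)\<in>Basis \<times> Basis. (\<lambda>vs. a [i, j] / 2 * t p i j vs)"
  have lin: "linear (\<lambda>v. complex_of_real (v \<bullet> i))" for i :: 'e
    by (simp add: linear_iff algebra_simps scaleR_conv_of_real)
  note w = wedge_in_bidegree[OF linear_J J_J]
  have t: "t p i j \<in> bidegree J p (2 - p)" if "p \<le> 2" for p i j
  proof -
    have "p = 0 \<or> p = 1 \<or> p = 2" using that by arith
    then consider "p = 0" | "p = 1" | "p = 2" by blast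
    then show ?thesis
    proof cases
      case 1
      then show ?thesis
        using w[of "[]" "[\<lambda>v. of_real (v \<bullet> i), \<lambda>v. of_real (v \<bullet> j)]"] lin by (auto simp: t_def numeral_2_eq_2)
    next
      case 2
      have "wedge [?P i, ?Q j] \<in> bidegree J 1 1" "wedge [?P j, ?Q i] \<in> bidegree J 1 1"
        using w[of "[\<lambda>v. of_real (v \<bullet> i)]" "[\<lambda>v. of_real (v \<bullet> j)]"]
          w[of "[\<lambda>v. of_real (v \<bullet> j)]" "[\<lambda>v. of_real (v \<bullet> i)]"] lin by auto
      then have "wedge [?P i, ?Q j] + (\<lambda>vs. - 1 * wedge [?P j, ?Q i] vs) \<in> bidegree J 1 1"
        unfolding bidegree_def by (intro span_add span_scale)
      then show ?thesis using 2 by (simp add: t_def plus_fun_def)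
    next
      case 3
      then show ?thesis
        using w[of "[\<lambda>v. of_real (v \<bullet> i), \<lambda>v. of_real (v \<bullet> j)]" "[]"] lin by (auto simp: t_def numeral_2_eq_2)
    qed
  qed
  show "?c p \<in> bidegree J p (2 - p)" if "p \<le> 2" for p
    using t[OF that] unfolding bidegree_def split_def by (intro span_sum span_scale)
  have t_sum: "(\<Sum>p\<le>2. t p i j vs) = wedge [\<lambda>v. of_real (v \<bullet> i), \<lambda>v. of_real (v \<bullet> j)] vs" for i j vs
  proof (cases "length vs = 2")
    case True
    then obtain v w where vs: "vs = [v, w]" by (auto simp: length_Suc_conv numeral_2_eq_2)
    have "wedge [type_01 J f, type_01 J g] vs +
        (wedge [type_10 J f, type_01 J g] vs - wedge [type_10 J g, type_01 J f] vs) +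
        wedge [type_10 J f, type_10 J g] vs = wedge [f, g] vs" for f g
      using types_add[OF linear_J J_J, of f v, symmetric] types_add[OF linear_J J_J, of f w, symmetric]
        types_add[OF linear_J J_J, of g v, symmetric] types_add[OF linear_J J_J, of g w, symmetric]
      by (simp add: vs wedge_2 algebra_simps)
    then show ?thesis
      by (simp add: t_def numeral_2_eq_2)
  next
    case False
    then show ?thesis by (simp add: t_def numeral_2_eq_2 wedge_length)
  qed
  show "a vs = (\<Sum>p\<le>2. ?c p vs)" for vs
  proof -
    have "(\<Sum>p\<le>2. ?c p vs) = (\<Sum>(i, j)\<in>Basis \<times> Basis. \<Sum>p\<le>2. a [i, j] / 2 * t p i j vs)"
      by (simp add: sum_fun_apply split_def) (rule sum.swap)
    also have "\<dots> = a vs"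
      unfolding sum_distrib_left[symmetric] t_sum covector_2_expand[OF assms, of vs] ..
    finally show ?thesis ..
  qed
qed

lemma map_J_in_complex_covectors_2:
  assumes "a \<in> complex_covectors 2"
  shows "(\<lambda>vs. a (map J vs)) \<in> complex_covectors 2"
proof (rule complex_covectors_2I)
  show "a (map J vs) = 0" if "length vs \<noteq> 2" for vs
    using assms that by (simp add: complex_covectors_def)
  show "linear (\<lambda>v. a (map J [v, w]))" for w
    using linear_compose[OF linear_J covector_2_linear(1)[OF assms, of "J w"]] by (simp add: comp_def)
  show "linear (\<lambda>w. a (map J [v, w]))" for v
    using linear_compose[OF linear_J covector_2_linear(2)[OF assms, of "J v"]] by (simp add: comp_def)
qed (simp add: covector_2_same[OF assms])

text \<open>Applying \<open>J\<close> twice changes the sign of both arguments, and the signs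
  cancel. So the action on 2-covectors is an involution, hence its own inverse.\<close>

lemma map_J_map_J:
  assumes "a \<in> complex_covectors 2"
  shows "a (map J (map J vs)) = a vs"
proof (cases "length vs = 2")
  case True
  then obtain v w where "vs = [v, w]" by (auto simp: length_Suc_conv numeral_2_eq_2)
  then show ?thesis
    using linear_neg[OF covector_2_linear(1)[OF assms, of "- w"], of v]
      linear_neg[OF covector_2_linear(2)[OF assms, of v], of w] by (simp add: J_J)
qed (use assms in \<open>simp add: complex_covectors_def\<close>)

lemma J_covector_inv_2:
  assumes "b \<in> complex_covectors 2"
  shows "J_covector_inv J 2 b = (\<lambda>vs. b (map J vs))"
  unfolding J_covector_inv_def
proof (rule inv_into_f_eq)
  show "inj_on (J_covector J 2) (complex_covectors 2)"
  proof (rule inj_onI)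
    fix a a' assume a: "a \<in> complex_covectors 2" "a' \<in> complex_covectors 2"
      and "J_covector J 2 a = J_covector J 2 a'"
    then have "a (map J (map J vs)) = a' (map J (map J vs))" for vs
      by (metis J_covector_2)
    then show "a = a'" using map_J_map_J[OF a(1)] map_J_map_J[OF a(2)] by (simp only: fun_eq_iff) simp
  qed
  show "J_covector J 2 (\<lambda>vs. b (map J vs)) = b"
    unfolding J_covector_2[OF map_J_in_complex_covectors_2[OF assms]]
    by (simp only: map_J_map_J[OF assms])
qed (rule map_J_in_complex_covectors_2[OF assms])

text \<open>Removes the outer inverse in \<open>dc\<close>: vanishing of d^c \<alpha> becomes
  closedness of J \<alpha>.\<close>

lemma J_covector_inv_2_eq_0_iff:
  assumes "b \<in> complex_covectors 2"
  shows "J_covector_inv J 2 b = (\<lambda>vs. 0) \<longleftrightarrow> b = (\<lambda>vs. 0)"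
  unfolding J_covector_inv_2[OF assms] by (metis map_J_map_J[OF assms])

end

section \<open>Tensor fields on the torus\<close>

text \<open>A single function on the covering space serves in all charts, because transitions have
  identity derivative; outside the charts the value is 0, as \<open>tensor_field\<close>
  demands.\<close>

definition torus_tensor ::
    "nat \<Rightarrow> (real ^ 'n \<Rightarrow> (real ^ 'n) list \<Rightarrow> 'b::real_normed_vector) \<Rightarrow>
      (complex ^ 'n, real ^ 'n, 'b) tensor" where
  "torus_tensor k T = (\<lambda>c x vs.
     if c \<in> torus_atlas \<and> x \<in> coords c \<and> length vs = k then T x vs else 0)"

lemma torus_tensor_chart:
  "x \<in> ball p 1 \<Longrightarrow> torus_tensor k T (torus_chart p) x vs = (if length vs = k then T x vs else 0)"
  by (simp add: torus_tensor_def torus_atlas_def coords_torus_chart)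

lemma tensor_field_torus_tensor:
  fixes T :: "real ^ 'n \<Rightarrow> (real ^ 'n) list \<Rightarrow> 'b::real_normed_vector"
  assumes "\<And>x vs i. length vs = k \<Longrightarrow> i < k \<Longrightarrow> linear (\<lambda>v. T x (vs[i := v]))"
    and "\<And>S vs. open S \<Longrightarrow> length vs = k \<Longrightarrow> smooth_on S (\<lambda>x. T x vs)"
    and "\<And>x y. torus_map x = torus_map y \<Longrightarrow> T x = T y"
  shows "tensor_field torus_atlas k (torus_tensor k T)"
  unfolding tensor_field_def
proof (intro conjI ballI allI impI)
  fix c :: "(complex ^ 'n, real ^ 'n) chart" and x and vs :: "(real ^ 'n) list"
  assume "\<not> (c \<in> torus_atlas \<and> x \<in> coords c \<and> length vs = k)"
  then show "torus_tensor k T c x vs = 0" by (auto simp: torus_tensor_def)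
next
  fix c :: "(complex ^ 'n, real ^ 'n) chart" and x and vs :: "(real ^ 'n) list" and i
  assume "c \<in> torus_atlas" "x \<in> coords c" "length vs = k \<and> i < k"
  then show "linear (\<lambda>v. torus_tensor k T c x (vs[i := v]))"
    using assms(1)[of vs i x] by (simp add: torus_tensor_def)
next
  fix c :: "(complex ^ 'n, real ^ 'n) chart" and vs :: "(real ^ 'n) list" assume "c \<in> torus_atlas"
  then obtain p where c: "c = torus_chart p" by (auto simp: torus_atlas_def)
  show "smooth_on (coords c) (\<lambda>x. torus_tensor k T c x vs)"
  proof (cases "length vs = k")
    case True
    then have "smooth_on (ball p 1) (\<lambda>x. T x vs)" by (intro assms(2)) auto
    then show ?thesis unfolding c coords_torus_chart
      by (subst smooth_on_cong[where g = "\<lambda>x. T x vs"]) (auto simp: torus_tensor_chart True)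
  next
    case False
    then have "(\<lambda>x. torus_tensor k T c x vs) = (\<lambda>x. 0)" by (auto simp: torus_tensor_def)
    then show ?thesis by (simp add: smooth_on_const)
  qed
next
  fix c d :: "(complex ^ 'n, real ^ 'n) chart" and x and vs :: "(real ^ 'n) list"
  assume "c \<in> torus_atlas" "d \<in> torus_atlas" and x: "x \<in> overlap c d"
  then obtain p q where c: "c = torus_chart p" "d = torus_chart q" by (auto simp: torus_atlas_def)
  obtain y where y: "x \<in> ball p 1" "y \<in> ball q 1" "torus_map x = torus_map y"
    using x unfolding c overlap_torus_chart by auto
  have "frechet_derivative (transition c d) (at x) = (\<lambda>v. v)"
    using frechet_derivative_at[OF has_derivative_transition_torus_chart] x c by metis
  then show "torus_tensor k T c x vs = torus_tensor k T d (transition c d x)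
      (map (frechet_derivative (transition c d) (at x)) vs)"
    using y assms(3)[OF y(3)] unfolding c transition_torus_chart[OF y]
    by (simp add: torus_tensor_chart)
qed

text \<open>The transformation law with identity derivatives. It lets the representatives in
  different charts be glued to a periodic object on the covering space.\<close>

lemma tensor_field_torus_charts:
  assumes "tensor_field torus_atlas k T"
    and "x \<in> ball p 1" "y \<in> ball q 1" "torus_map x = torus_map y"
  shows "T (torus_chart p) x vs = T (torus_chart q) y vs"
proof -
  let ?f = "transition (torus_chart p) (torus_chart q)"
  have x: "x \<in> overlap (torus_chart p) (torus_chart q)"
    using assms(2-4) by (auto simp: overlap_torus_chart)
  then have "frechet_derivative ?f (at x) = (\<lambda>v. v)"
    using frechet_derivative_at[OF has_derivative_transition_torus_chart] by metis
  moreover have "T (torus_chart p) x vs =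
      T (torus_chart q) (?f x) (map (frechet_derivative ?f (at x)) vs)"
    using assms(1) x unfolding tensor_field_def torus_atlas_def by blast
  ultimately show ?thesis
    using transition_torus_chart[OF assms(2-4)] by simp
qed

lemma torus_atlas_cases:
  assumes "c \<in> torus_atlas" "x \<in> coords c"
  obtains p where "c = torus_chart p" "x \<in> ball p 1"
  using assms by (auto simp: torus_atlas_def coords_torus_chart)

lemma ext_deriv_torus_locally_constant:
  assumes "\<And>p vs. \<exists>a. \<forall>x\<in>ball p 1. \<alpha> (torus_chart p) x vs = a"
  shows "ext_deriv torus_atlas \<alpha> = (\<lambda>c x vs. 0)"
proof -
  have "frechet_derivative (\<lambda>y. \<alpha> (torus_chart p) y vs) (at x) = (\<lambda>v. 0)" if "x \<in> ball p 1" for p x vs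
  proof -
    obtain a where "\<forall>x\<in>ball p 1. \<alpha> (torus_chart p) x vs = a" using assms by blast
    then show ?thesis
      using frechet_derivative_cong_open[OF open_ball that, of "\<lambda>y. \<alpha> (torus_chart p) y vs" "\<lambda>y. a"]
      by simp
  qed
  then show ?thesis
    by (auto simp: ext_deriv_def fun_eq_iff elim!: torus_atlas_cases)
qed

section \<open>Lifting 1-forms to the covering space\<close>

lemma torus_1_form_covector:
  assumes "\<alpha> \<in> forms torus_atlas 1" "x \<in> ball p 1"
  shows "\<alpha> (torus_chart p) x \<in> complex_covectors 1"
proof -
  have "torus_chart p \<in> torus_atlas" "x \<in> coords (torus_chart p)"
    using assms(2) by (auto simp: torus_atlas_def coords_torus_chart)
  then show ?thesis
    using assms(1) unfolding forms_def complex_covectors_def tensor_field_def by blast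
qed

text \<open>The pullback along the covering, read off at each \<open>x\<close> in the chart centred
  at \<open>x\<close>.\<close>

definition torus_lift ::
    "(complex ^ 'n, real ^ 'n, 'b) tensor \<Rightarrow> real ^ 'n \<Rightarrow> real ^ 'n \<Rightarrow> 'b" where
  "torus_lift \<alpha> x v = \<alpha> (torus_chart x) x [v]"

lemma torus_lift_chart:
  assumes "tensor_field torus_atlas 1 \<alpha>" "x \<in> ball p 1"
  shows "\<alpha> (torus_chart p) x vs = (if length vs = 1 then torus_lift \<alpha> x (hd vs) else 0)"
proof (cases "length vs = 1")
  case True
  then have "vs = [hd vs]" by (cases vs) auto
  then show ?thesis
    using tensor_field_torus_charts[OF assms, of x x vs] True by (simp add: torus_lift_def)
next
  case False
  moreover have "\<alpha> (torus_chart p) x vs = 0"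
    using assms(1) False unfolding tensor_field_def by blast
  ultimately show ?thesis by simp
qed

lemma torus_lift_periodic:
  assumes "tensor_field torus_atlas 1 \<alpha>" "torus_map x = torus_map y"
  shows "torus_lift \<alpha> x v = torus_lift \<alpha> y v"
  unfolding torus_lift_def by (rule tensor_field_torus_charts[OF assms(1) _ _ assms(2)]) simp_all

lemma torus_lift_linear:
  assumes "tensor_field torus_atlas 1 \<alpha>"
  shows "linear (torus_lift \<alpha> x)"
proof -
  have "\<forall>c\<in>torus_atlas. \<forall>x\<in>coords c. \<forall>vs i. length vs = 1 \<and> i < 1 \<longrightarrow> linear (\<lambda>v. \<alpha> c x (vs[i := v]))"
    using assms by (simp add: tensor_field_def)
  from this[rule_format, of "torus_chart x" x "[0]" 0] have "linear (\<lambda>v. \<alpha> (torus_chart x) x [v])"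
    by (simp add: torus_atlas_def coords_torus_chart)
  then show ?thesis by (simp add: torus_lift_def[abs_def])
qed

lemma torus_lift_differentiable:
  assumes "tensor_field torus_atlas 1 \<alpha>"
  shows "(\<lambda>x. torus_lift \<alpha> x v) differentiable (at x)"
proof -
  have "smooth_on (ball x 1) (\<lambda>y. \<alpha> (torus_chart x) y [v])"
    using assms unfolding tensor_field_def torus_atlas_def by (metis coords_torus_chart rangeI)
  then have "(\<lambda>y. \<alpha> (torus_chart x) y [v]) differentiable (at x)"
    by (rule smooth_on_imp_differentiable) simp
  then show ?thesis
    using differentiable_cong_open[of "ball x 1" x "\<lambda>y. \<alpha> (torus_chart x) y [v]" "\<lambda>x. torus_lift \<alpha> x v"]
    by (simp add: torus_lift_chart[OF assms])
qed

text \<open>A continuous periodic function takes all its values on the compact cube. Such bounds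
  feed Liouville's theorem.\<close>

lemma torus_lift_bounded:
  assumes "tensor_field torus_atlas 1 \<alpha>"
  shows "bounded (range (\<lambda>x. torus_lift \<alpha> x v))"
proof -
  have "continuous_on UNIV (\<lambda>x. torus_lift \<alpha> x v)"
    using torus_lift_differentiable[OF assms]
    by (auto intro!: continuous_at_imp_continuous_on differentiable_imp_continuous_within)
  then have "compact ((\<lambda>x. torus_lift \<alpha> x v) ` cbox 0 (\<chi> i. 2 * pi))"
    by (intro compact_continuous_image compact_cbox) (rule continuous_on_subset, auto)
  moreover have "range (\<lambda>x. torus_lift \<alpha> x v) \<subseteq> (\<lambda>x. torus_lift \<alpha> x v) ` cbox 0 (\<chi> i. 2 * pi)"
  proof
    fix z assume "z \<in> range (\<lambda>x. torus_lift \<alpha> x v)"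
    then obtain x where z: "z = torus_lift \<alpha> x v" by auto
    obtain y where "y \<in> cbox 0 (\<chi> i. 2 * pi)" "torus_map y = torus_map x"
      using torus_map_reduce[of x] by blast
    then show "z \<in> (\<lambda>x. torus_lift \<alpha> x v) ` cbox 0 (\<chi> i. 2 * pi)"
      using torus_lift_periodic[OF assms] z by (metis (mono_tags, lifting) image_iff)
  qed
  ultimately show ?thesis using bounded_subset compact_imp_bounded by blast
qed

text \<open>Applies to \<alpha> with its lift and also to \<open>J_form\<close> of \<alpha>, without
  first proving the latter to be a tensor field.\<close>

definition represents_1_form ::
    "(real ^ 'n \<Rightarrow> real ^ 'n \<Rightarrow> 'b::zero) \<Rightarrow> (complex ^ 'n, real ^ 'n, 'b) tensor \<Rightarrow> bool" where
  "represents_1_form b \<beta> \<longleftrightarrow> (\<forall>p. \<forall>x\<in>ball p 1. \<forall>vs.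
     \<beta> (torus_chart p) x vs = (if length vs = 1 then b x (hd vs) else 0))"

lemma represents_1_formD:
  "represents_1_form b \<beta> \<Longrightarrow> x \<in> ball p 1 \<Longrightarrow>
    \<beta> (torus_chart p) x vs = (if length vs = 1 then b x (hd vs) else 0)"
  unfolding represents_1_form_def by blast

lemma ext_deriv_torus_1_form:
  assumes "represents_1_form b \<beta>"
    and "x \<in> ball p 1"
  shows "ext_deriv torus_atlas \<beta> (torus_chart p) x vs = (if length vs = 2 then
    frechet_derivative (\<lambda>y. b y (vs ! 1)) (at x) (vs ! 0) -
    frechet_derivative (\<lambda>y. b y (vs ! 0)) (at x) (vs ! 1) else 0)"
proof -
  have A: "torus_chart p \<in> torus_atlas" "x \<in> coords (torus_chart p)"
    using assms(2) by (auto simp: torus_atlas_def coords_torus_chart)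
  have D: "frechet_derivative (\<lambda>y. \<beta> (torus_chart p) y us) (at x) =
      (if length us = 1 then frechet_derivative (\<lambda>y. b y (hd us)) (at x) else (\<lambda>v. 0))" for us
    using frechet_derivative_cong_open[OF open_ball assms(2),
        of "\<lambda>y. \<beta> (torus_chart p) y us" "\<lambda>y. if length us = 1 then b y (hd us) else 0"]
    by (simp add: represents_1_formD[OF assms(1)])
  show ?thesis
  proof (cases "length vs = 2")
    case True
    then obtain v w where "vs = [v, w]" by (auto simp: length_Suc_conv numeral_2_eq_2)
    with A show ?thesis by (simp add: ext_deriv_def D numeral_2_eq_2)
  next
    case False
    \<comment> \<open>Omitting one of a number of arguments other than 2 never leaves exactly one,
      and on such lists \<beta> vanishes.\<close>
    have "length (take i vs @ drop (Suc i) vs) \<noteq> 1" if "i < length vs" for i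
      using that False by auto
    then show ?thesis using A False by (simp add: ext_deriv_def D)
  qed
qed

text \<open>Puts the derivative within reach of \<open>J_covector_inv_2_eq_0_iff\<close>. Linearity
  in each slot combines linearity of a derivative in its direction with linearity of
  \<open>b x\<close>.\<close>

lemma ext_deriv_torus_covector:
  assumes "represents_1_form b \<beta>"
    and "\<And>x. linear (b x)" "\<And>x v. (\<lambda>y. b y v) differentiable (at x)"
    and "x \<in> ball p 1"
  shows "ext_deriv torus_atlas \<beta> (torus_chart p) x \<in> complex_covectors 2"
proof -
  have l1: "linear (frechet_derivative (\<lambda>y. b y v) (at x))" for v
    by (rule linear_frechet_derivative[OF assms(3)])
  have l2: "linear (\<lambda>v. frechet_derivative (\<lambda>y. b y v) (at x) w)" for w
  proof (rule linearI)
    fix u v and r :: real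
    have "frechet_derivative (\<lambda>y. b y u + b y v) (at x) =
        (\<lambda>w. frechet_derivative (\<lambda>y. b y u) (at x) w + frechet_derivative (\<lambda>y. b y v) (at x) w)"
      by (rule frechet_derivative_at[symmetric], intro has_derivative_add)
        (use assms(3) frechet_derivative_works in blast)+
    then show "frechet_derivative (\<lambda>y. b y (u + v)) (at x) w =
        frechet_derivative (\<lambda>y. b y u) (at x) w + frechet_derivative (\<lambda>y. b y v) (at x) w"
      by (simp add: linear_add[OF assms(2)])
    have "frechet_derivative (\<lambda>y. r *\<^sub>R b y v) (at x) =
        (\<lambda>w. r *\<^sub>R frechet_derivative (\<lambda>y. b y v) (at x) w)"
      by (rule frechet_derivative_at[symmetric], intro has_derivative_scaleR_right)
        (use assms(3) frechet_derivative_works in blast)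
    then show "frechet_derivative (\<lambda>y. b y (r *\<^sub>R v)) (at x) w =
        r *\<^sub>R frechet_derivative (\<lambda>y. b y v) (at x) w"
      by (simp add: linear_scale[OF assms(2)])
  qed
  show ?thesis
    by (rule complex_covectors_2I)
      (auto simp: ext_deriv_torus_1_form[OF assms(1,4)] intro!: linear_compose_sub l1 l2)
qed

lemma ext_deriv_torus_1_form_eq_0_iff:
  assumes "represents_1_form b \<beta>"
  shows "ext_deriv torus_atlas \<beta> = (\<lambda>c x vs. 0) \<longleftrightarrow>
    (\<forall>x v w. frechet_derivative (\<lambda>y. b y w) (at x) v = frechet_derivative (\<lambda>y. b y v) (at x) w)"
proof
  assume *: "ext_deriv torus_atlas \<beta> = (\<lambda>c x vs. 0)"
  show "\<forall>x v w. frechet_derivative (\<lambda>y. b y w) (at x) v = frechet_derivative (\<lambda>y. b y v) (at x) w"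
  proof (intro allI)
    fix x v w
    show "frechet_derivative (\<lambda>y. b y w) (at x) v = frechet_derivative (\<lambda>y. b y v) (at x) w"
      using ext_deriv_torus_1_form[OF assms, of x x "[v, w]"] * by simp
  qed
next
  assume *: "\<forall>x v w. frechet_derivative (\<lambda>y. b y w) (at x) v = frechet_derivative (\<lambda>y. b y v) (at x) w"
  have "ext_deriv torus_atlas \<beta> c x vs = 0" for c x vs
  proof (cases "c \<in> torus_atlas \<and> x \<in> coords c")
    case True
    then obtain p where "c = torus_chart p" "x \<in> ball p 1" using torus_atlas_cases by metis
    then show ?thesis using ext_deriv_torus_1_form[OF assms, of x p vs] * by simp
  qed (auto simp: ext_deriv_def)
  then show "ext_deriv torus_atlas \<beta> = (\<lambda>c x vs. 0)" by (simp add: fun_eq_iff)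
qed

text \<open>J \<alpha> is represented by the lift of \<alpha> precomposed with \<open>J\<close>, and
  the outer inverse of \<open>J\<close> is injective at each point. What remains is the symmetry of
  derivatives expressing d(J \<alpha>) = 0.\<close>

lemma dc_torus_eq_0_iff:
  fixes J :: "real ^ 'n \<Rightarrow> real ^ 'n \<Rightarrow> real ^ 'n"
  assumes "\<alpha> \<in> complex_forms torus_atlas 1"
    and J: "\<And>x. linear (J x)" "\<And>x v. J x (J x v) = - v"
    and diff: "\<And>v x. (\<lambda>y. torus_lift \<alpha> y (J y v)) differentiable (at x)"
  shows "dc torus_atlas (\<lambda>c. J) 1 \<alpha> = (\<lambda>c x vs. 0) \<longleftrightarrow>
    (\<forall>x v w. frechet_derivative (\<lambda>y. torus_lift \<alpha> y (J y w)) (at x) v =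
      frechet_derivative (\<lambda>y. torus_lift \<alpha> y (J y v)) (at x) w)"
proof -
  have tf: "tensor_field torus_atlas 1 \<alpha>" using assms(1) by (simp add: forms_def)
  let ?\<beta> = "J_form torus_atlas (\<lambda>c. J) 1 \<alpha>"
  have "?\<beta> (torus_chart p) x vs = (if length vs = 1 then torus_lift \<alpha> x (J x (hd vs)) else 0)"
    if "x \<in> ball p 1" for p x vs
  proof -
    have "?\<beta> (torus_chart p) x vs = J_covector (J x) 1 (\<alpha> (torus_chart p) x) vs"
      using that by (simp add: J_form_def torus_atlas_def coords_torus_chart)
    also have "\<dots> = \<alpha> (torus_chart p) x (map (J x) vs)"
      by (simp only: J_covector_1[OF J torus_1_form_covector[OF assms(1) that]])
    also have "\<dots> = (if length vs = 1 then torus_lift \<alpha> x (J x (hd vs)) else 0)"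
      by (cases vs) (simp_all add: torus_lift_chart[OF tf that])
    finally show ?thesis .
  qed
  then have \<beta>: "represents_1_form (\<lambda>x v. torus_lift \<alpha> x (J x v)) ?\<beta>"
    by (simp add: represents_1_form_def)
  have lin: "linear (\<lambda>v. torus_lift \<alpha> x (J x v))" for x
    using linear_compose[OF J(1) torus_lift_linear[OF tf], of x x] by (simp add: comp_def)
  have cov: "ext_deriv torus_atlas ?\<beta> (torus_chart p) x \<in> complex_covectors 2" if "x \<in> ball p 1" for p x
    by (rule ext_deriv_torus_covector[OF \<beta> lin diff that])
  have "dc torus_atlas (\<lambda>c. J) 1 \<alpha> = (\<lambda>c x vs. 0) \<longleftrightarrow>
      (\<forall>p. \<forall>x\<in>ball p 1. J_covector_inv (J x) 2 (ext_deriv torus_atlas ?\<beta> (torus_chart p) x) = (\<lambda>vs. 0))"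
    (is "?l \<longleftrightarrow> ?r")
  proof
    assume ?l
    show ?r
    proof (intro allI ballI)
      fix p x :: "real ^ 'n" assume "x \<in> ball p 1"
      then show "J_covector_inv (J x) 2 (ext_deriv torus_atlas ?\<beta> (torus_chart p) x) = (\<lambda>vs. 0)"
        using fun_cong[OF fun_cong[OF \<open>?l\<close>, of "torus_chart p"], of x]
        by (simp add: dc_def J_form_inv_def torus_atlas_def coords_torus_chart numeral_2_eq_2)
    qed
  next
    assume ?r
    have "dc torus_atlas (\<lambda>c. J) 1 \<alpha> c x vs = 0" for c x vs
    proof (cases "c \<in> torus_atlas \<and> x \<in> coords c")
      case True
      then obtain p where p: "c = torus_chart p" "x \<in> ball p 1" using torus_atlas_cases by metis
      then show ?thesis
        using \<open>?r\<close>[rule_format, OF p(2)] True by (simp add: dc_def J_form_inv_def numeral_2_eq_2)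
    qed (auto simp: dc_def J_form_inv_def)
    then show ?l by (simp add: fun_eq_iff)
  qed
  also have "\<dots> \<longleftrightarrow> (\<forall>p. \<forall>x\<in>ball p 1. ext_deriv torus_atlas ?\<beta> (torus_chart p) x = (\<lambda>vs. 0))"
    using J_covector_inv_2_eq_0_iff[OF J cov] by blast
  also have "\<dots> \<longleftrightarrow> ext_deriv torus_atlas ?\<beta> = (\<lambda>c x vs. 0)" (is "?l \<longleftrightarrow> ?r")
  proof
    assume ?l
    have "ext_deriv torus_atlas ?\<beta> c x vs = 0" for c x vs
    proof (cases "c \<in> torus_atlas \<and> x \<in> coords c")
      case True
      then obtain p where p: "c = torus_chart p" "x \<in> ball p 1" using torus_atlas_cases by metis
      then show ?thesis using \<open>?l\<close>[rule_format, OF p(2)] by simp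
    qed (auto simp: ext_deriv_def)
    then show ?r by (simp add: fun_eq_iff)
  qed simp
  also have "\<dots> \<longleftrightarrow> (\<forall>x v w. frechet_derivative (\<lambda>y. torus_lift \<alpha> y (J y w)) (at x) v =
      frechet_derivative (\<lambda>y. torus_lift \<alpha> y (J y v)) (at x) w)"
    by (rule ext_deriv_torus_1_form_eq_0_iff[OF \<beta>])
  finally show ?thesis .
qed

section \<open>Closed forms whose image under \<open>J\<close> is closed\<close>

lemma line_derivative:
  assumes "f differentiable (at (x + t *\<^sub>R v))"
  shows "((\<lambda>t. f (x + t *\<^sub>R v)) has_vector_derivative frechet_derivative f (at (x + t *\<^sub>R v)) v) (at t)"
proof -
  have "((\<lambda>t. x + t *\<^sub>R v) has_vector_derivative v) (at t)"
    by (auto intro!: derivative_eq_intros)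
  moreover have "(f has_derivative frechet_derivative f (at (x + t *\<^sub>R v))) (at (x + t *\<^sub>R v))"
    using assms frechet_derivative_works by blast
  ultimately show ?thesis
    using vector_derivative_diff_chain_within[of "\<lambda>t. x + t *\<^sub>R v" v t UNIV f]
    by (simp add: comp_def has_derivative_at_withinI)
qed

text \<open>A directional derivative sees only the values on one line. This compares functions that
  coincide merely on a line, or one function on two parallel lines.\<close>

lemma frechet_derivative_eq_along_lines:
  assumes "f differentiable (at x)" "g differentiable (at y)"
    and "\<And>t. f (x + t *\<^sub>R v) = g (y + t *\<^sub>R v)"
  shows "frechet_derivative f (at x) v = frechet_derivative g (at y) v"
  using line_derivative[of f x 0 v] line_derivative[of g y 0 v] assms
  by (simp add: vector_derivative_unique_at)

lemma frechet_derivative_add_mult: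
  fixes f g :: "'a::real_normed_vector \<Rightarrow> complex"
  assumes "f differentiable (at x)" "g differentiable (at x)"
  shows "(\<lambda>y. f y + c * g y) differentiable (at x)"
    and "frechet_derivative (\<lambda>y. f y + c * g y) (at x) v =
      frechet_derivative f (at x) v + c * frechet_derivative g (at x) v"
proof -
  have D: "((\<lambda>y. f y + c * g y) has_derivative
      (\<lambda>v. frechet_derivative f (at x) v + c * frechet_derivative g (at x) v)) (at x)"
    using assms unfolding frechet_derivative_works by (intro derivative_intros)
  then show "(\<lambda>y. f y + c * g y) differentiable (at x)"
    unfolding differentiable_def by blast
  show "frechet_derivative (\<lambda>y. f y + c * g y) (at x) v =
      frechet_derivative f (at x) v + c * frechet_derivative g (at x) v"
    by (simp only: frechet_derivative_at[OF D, symmetric])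
qed

lemma zero_derivative_along_line:
  assumes "\<And>y. f differentiable (at y)"
    and "\<And>t. frechet_derivative f (at (x + t *\<^sub>R v)) v = 0"
  shows "f (x + t *\<^sub>R v) = f x"
proof -
  have "((\<lambda>t. f (x + t *\<^sub>R v)) has_derivative (\<lambda>h. 0)) (at t within UNIV)" for t
    using line_derivative[OF assms(1), where x = x and t = t and v = v] by (simp add: assms(2) has_vector_derivative_def)
  from has_derivative_zero_constant[OF convex_UNIV this]
  obtain c where "f (x + t *\<^sub>R v) = c" for t by blast
  from this[of t] this[of 0] show ?thesis by simp
qed

text \<open>With constant slope \<open>f\<close> is affine along the line, and a nonconstant affine
  function is unbounded.\<close>

lemma bounded_constant_slope:
  assumes "\<And>y. f differentiable (at y)" "bounded (range f)"
    and "\<And>t. frechet_derivative f (at (x + t *\<^sub>R v)) v = k"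
  shows "k = 0"
proof (rule ccontr)
  assume k: "k \<noteq> 0"
  have "((\<lambda>t. f (x + t *\<^sub>R v) - t *\<^sub>R k) has_derivative (\<lambda>h. 0)) (at t within UNIV)" for t
    using line_derivative[OF assms(1), where x = x and t = t and v = v] unfolding assms(3) has_vector_derivative_def
    by (auto intro!: derivative_eq_intros)
  from has_derivative_zero_constant[OF convex_UNIV this]
  obtain c where c: "f (x + t *\<^sub>R v) - t *\<^sub>R k = c" for t by blast
  obtain M where M: "\<And>y. norm (f y) \<le> M" using assms(2) by (auto simp: bounded_iff)
  have "norm (t *\<^sub>R k) \<le> 2 * M" for t
  proof -
    have "t *\<^sub>R k = f (x + t *\<^sub>R v) - f x" using c[of t] c[of 0] by (simp add: algebra_simps)
    then show ?thesis
      using norm_triangle_ineq4[of "f (x + t *\<^sub>R v)" "f x"] M[of "x + t *\<^sub>R v"] M[of x] by simp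
  qed
  \<comment> \<open>At this parameter the norm of the increment is at least 2 M + 1.\<close>
  from this[of "(2 * M + 1) / norm k"] k show False by simp
qed

text \<open>The hypothesis is the Cauchy-Riemann equation in the coordinate s + \<i> t, so
  \<open>g\<close> is a bounded entire function on the plane.\<close>

lemma Liouville_plane:
  fixes g :: "'a::real_normed_vector \<Rightarrow> complex"
  assumes "\<And>y. g differentiable (at y)" "bounded (range g)"
    and "\<And>s t. frechet_derivative g (at (x + s *\<^sub>R d + t *\<^sub>R d')) d' =
      \<i> * frechet_derivative g (at (x + s *\<^sub>R d + t *\<^sub>R d')) d"
  shows "g (x + s *\<^sub>R d + t *\<^sub>R d') = g x"
proof -
  define l where "l z = x + Re z *\<^sub>R d + Im z *\<^sub>R d'" for z
  have "((\<lambda>z. g (l z)) has_field_derivative frechet_derivative g (at (l z)) d) (at z)" for z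
  proof -
    let ?D = "frechet_derivative g (at (l z))"
    have D: "(g has_derivative ?D) (at (l z))"
      using assms(1) frechet_derivative_works by blast
    have "(l has_derivative (\<lambda>h. Re h *\<^sub>R d + Im h *\<^sub>R d')) (at z)"
      unfolding l_def by (auto intro!: derivative_eq_intros)
    from has_derivative_compose[OF this D]
    have "((\<lambda>z. g (l z)) has_derivative (\<lambda>h. ?D (Re h *\<^sub>R d + Im h *\<^sub>R d'))) (at z)" .
    moreover have "?D (Re h *\<^sub>R d + Im h *\<^sub>R d') = ?D d * h" for h
    proof -
      have "?D (Re h *\<^sub>R d + Im h *\<^sub>R d') = Re h *\<^sub>R ?D d + Im h *\<^sub>R ?D d'"
        using linear_frechet_derivative[OF assms(1)] by (simp add: linear_add linear_scale)
      also have "?D d' = \<i> * ?D d" using assms(3) by (simp add: l_def)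
      also have "Re h *\<^sub>R ?D d + Im h *\<^sub>R (\<i> * ?D d) = ?D d * (of_real (Re h) + \<i> * of_real (Im h))"
        by (simp add: scaleR_conv_of_real algebra_simps)
      finally show ?thesis by (simp flip: complex_eq)
    qed
    ultimately show ?thesis by (simp add: has_field_derivative_def)
  qed
  then have "(\<lambda>z. g (l z)) holomorphic_on UNIV"
    by (auto simp: holomorphic_on_def field_differentiable_def intro: has_field_derivative_at_within)
  moreover have "bounded (range (\<lambda>z. g (l z)))"
    by (rule bounded_subset[OF assms(2)]) auto
  ultimately have "(\<lambda>z. g (l z)) constant_on UNIV" by (rule Liouville_theorem)
  then have "g (l (Complex s t)) = g (l 0)" by (auto simp: constant_on_def)
  then show ?thesis by (simp add: l_def)
qed

context
  fixes A :: "'a::real_normed_vector \<Rightarrow> 'a \<Rightarrow> complex" and J :: "'a \<Rightarrow> 'a \<Rightarrow> 'a"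
  assumes linear_A: "\<And>x. linear (A x)"
    and J_J: "\<And>x v. J x (J x v) = - v"
    and diff_A: "\<And>v x. (\<lambda>y. A y v) differentiable (at x)"
    and diff_B: "\<And>v x. (\<lambda>y. A y (J y v)) differentiable (at x)"
    and bounded_A: "\<And>v. bounded (range (\<lambda>x. A x v))"
    and closed_A: "\<And>x v w. frechet_derivative (\<lambda>y. A y w) (at x) v = frechet_derivative (\<lambda>y. A y v) (at x) w"
    and closed_B: "\<And>x v w. frechet_derivative (\<lambda>y. A y (J y w)) (at x) v =
      frechet_derivative (\<lambda>y. A y (J y v)) (at x) w"
begin

text \<open>As \<open>J d\<close> is constant on the plane, the components along the plane of the forms
  \<open>A \<mp> \<i> A \<circ> J\<close> are holomorphic respectively antiholomorphic, hence constant.\<close>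

lemma constant_along_plane:
  assumes J: "\<And>s t. J (x + s *\<^sub>R d + t *\<^sub>R J x d) d = J x d"
  shows "A (x + s *\<^sub>R d + t *\<^sub>R J x d) d = A x d"
proof -
  define e where "e = J x d"
  define y where "y s t = x + s *\<^sub>R d + t *\<^sub>R e" for s t
  let ?D = "\<lambda>f s t. frechet_derivative f (at (y s t))"
  have Jd: "J (y s t) d = e" for s t using J by (simp add: y_def e_def)
  then have Je: "J (y s t) e = - d" for s t using J_J by metis
  have yd: "y s t + r *\<^sub>R d = y (s + r) t" and ye: "y s t + r *\<^sub>R e = y s (t + r)" for s t r
    by (simp_all add: y_def algebra_simps)
  \<comment> \<open>Closedness of A \<circ> J on the pair d, e, where A \<circ> J takes d to A(e)
    and e to - A(d). With \<open>closed_A\<close> on the same pair this is a Cauchy-Riemann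
    system.\<close>
  have De: "?D (\<lambda>y. A y e) s t e = - ?D (\<lambda>y. A y d) s t d" for s t
  proof -
    have "?D (\<lambda>y. A y e) s t e = ?D (\<lambda>y. A y (J y d)) s t e"
      by (rule frechet_derivative_eq_along_lines[OF diff_A diff_B]) (simp add: ye Jd)
    also have "\<dots> = ?D (\<lambda>y. A y (J y e)) s t d" by (rule closed_B)
    also have "\<dots> = ?D (\<lambda>y. (\<lambda>y. 0) y + - 1 * A y d) s t d"
      by (rule frechet_derivative_eq_along_lines[OF diff_B frechet_derivative_add_mult(1)])
        (auto simp: yd Je diff_A diff_B linear_neg[OF linear_A])
    also have "\<dots> = - ?D (\<lambda>y. A y d) s t d"
      by (subst frechet_derivative_add_mult(2)) (auto simp: diff_A)
    finally show ?thesis .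
  qed
  have g: "A (y s t) d + c * A (y s t) e = A x d + c * A x e" if c: "c = \<i> \<or> c = - \<i>" for c s t
  proof -
    let ?g = "\<lambda>y. A y d + c * A y e"
    have "bounded (range ?g)"
    proof -
      obtain M N where "\<And>x. norm (A x d) \<le> M" "\<And>x. norm (A x e) \<le> N"
        using bounded_A[of d] bounded_A[of e] by (auto simp: bounded_iff)
      moreover have "norm (?g y) \<le> norm (A y d) + norm (A y e)" for y
        using norm_triangle_ineq[of "A y d" "c * A y e"] c by (auto simp: norm_mult)
      ultimately have "norm (?g y) \<le> M + N" for y
        by (meson add_mono order_trans)
      then show ?thesis by (auto simp: bounded_iff)
    qed
    note Liouville = Liouville_plane[of ?g, OF frechet_derivative_add_mult(1)[OF diff_A diff_A] this]
    \<comment> \<open>As the square of \<open>c\<close> is - 1, the two equations combine: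
      \<open>?g\<close> is holomorphic for \<open>c = - \<i>\<close> and antiholomorphic for
      \<open>c = \<i>\<close>.\<close>
    have "?D ?g s t e = - c * ?D ?g s t d" for s t
    proof -
      have "?D ?g s t e = ?D (\<lambda>y. A y e) s t d - c * ?D (\<lambda>y. A y d) s t d"
        by (simp add: frechet_derivative_add_mult(2)[OF diff_A diff_A] De closed_A[where v = e and w = d])
      also have "\<dots> = - c * ?D ?g s t d"
        using c by (auto simp: frechet_derivative_add_mult(2)[OF diff_A diff_A] algebra_simps)
      finally show ?thesis .
    qed
    note D = this
    show ?thesis
    proof (cases "c = - \<i>")
      case True
      show ?thesis
        using Liouville[of x d e s t] D True unfolding y_def by simp
    next
      case False
      then have "c = \<i>" using c by simp
      \<comment> \<open>Replacing \<open>e\<close> by \<open>- e\<close> conjugates the coordinate,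
        making the antiholomorphic case holomorphic.\<close>
      have "?D ?g s t (- e) = \<i> * ?D ?g s t d" for s t
        using D[of s t] \<open>c = \<i>\<close>
          linear_neg[OF linear_frechet_derivative[OF frechet_derivative_add_mult(1)[OF diff_A diff_A]], of d c e "y s t" e]
        by simp
      from this[of _ "- _"] show ?thesis
        using Liouville[of x d "- e" s "- t"] unfolding y_def by simp
    qed
  qed
  \<comment> \<open>Adding the two constant combinations eliminates the component along
    \<open>e\<close>.\<close>
  have "(A (y s t) d + \<i> * A (y s t) e) + (A (y s t) d + - \<i> * A (y s t) e) =
      (A x d + \<i> * A x e) + (A x d + - \<i> * A x e)"
    by (intro arg_cong2[of _ _ _ _ "(+)"] g) simp_all
  then have "A (y s t) d = A x d" by simp
  then show ?thesis by (simp add: y_def e_def)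
qed

text \<open>With J d in place of d the plane stays the same, as J (J d) = - d; the coordinates (s,
  t) become (t, - s).\<close>

lemma constant_along_plane_J:
  assumes J: "\<And>s t. J (x + s *\<^sub>R d + t *\<^sub>R J x d) d = J x d"
  shows "A (x + s *\<^sub>R d + t *\<^sub>R J x d) (J x d) = A x (J x d)"
proof -
  have e: "x + r *\<^sub>R J x d + q *\<^sub>R J x (J x d) = x + (- q) *\<^sub>R d + r *\<^sub>R J x d" for r q
    by (simp add: J_J)
  have "J (x + s *\<^sub>R d + t *\<^sub>R J x d) (J x d) = J x (J x d)" for s t
    using J J_J by metis
  then have "J (x + r *\<^sub>R J x d + q *\<^sub>R J x (J x d)) (J x d) = J x (J x d)" for r q
    unfolding e .
  from constant_along_plane[OF this, of t "- s"] show ?thesis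
    unfolding e by simp
qed

end

section \<open>A compatible almost complex structure twisted along a circle\<close>

definition vec4 :: "'b \<Rightarrow> 'b \<Rightarrow> 'b \<Rightarrow> 'b \<Rightarrow> 'b ^ 4" where
  "vec4 a b c d = (\<chi> i. if i = 1 then a else if i = 2 then b else if i = 3 then c else d)"

lemma vec4_nth [simp]:
  "vec4 a b c d $ 1 = a" "vec4 a b c d $ 2 = b" "vec4 a b c d $ 3 = c" "vec4 a b c d $ 4 = d"
  by (simp_all add: vec4_def)

lemma vec4_eq_iff: "x = (y :: 'b ^ 4) \<longleftrightarrow> x $ 1 = y $ 1 \<and> x $ 2 = y $ 2 \<and> x $ 3 = y $ 3 \<and> x $ 4 = y $ 4"
  by (simp add: vec_eq_iff forall_4)

text \<open>The first block is the standard structure conjugated by the shear sending \<partial>_1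
  to \<partial>_1 + s \<partial>_2, which has determinant 1 and so preserves dx_1 \<and>
  dx_2.\<close>

definition twisted_J :: "real \<Rightarrow> real ^ 4 \<Rightarrow> real ^ 4 \<Rightarrow> real ^ 4" where
  "twisted_J r x v = (let s = r * sin (x $ 3) in
     vec4 (s * v $ 1 - v $ 2) ((1 + s\<^sup>2) * v $ 1 - s * v $ 2) (- v $ 4) (v $ 3))"

lemma linear_twisted_J: "linear (twisted_J r x)"
  by (rule linearI) (simp_all add: twisted_J_def Let_def vec4_eq_iff algebra_simps)

lemma twisted_J_twisted_J: "twisted_J r x (twisted_J r x v) = - v"
  by (simp add: twisted_J_def Let_def vec4_eq_iff algebra_simps power2_eq_square)

lemma smooth_on_twisted_J: "smooth_on S (\<lambda>x. twisted_J r x v)"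
proof -
  have "twisted_J r x v = vec4 (- v $ 2) ((1 + r\<^sup>2 / 2) * v $ 1) (- v $ 4) (v $ 3) +
      sin (x $ 3) *\<^sub>R vec4 (r * v $ 1) (- r * v $ 2) 0 0 +
      cos (2 * x $ 3) *\<^sub>R vec4 0 (- r\<^sup>2 / 2 * v $ 1) 0 0" for x
    by (simp add: twisted_J_def Let_def vec4_eq_iff cos_double_sin field_simps power2_eq_square)
  then show ?thesis using smooth_on_trigonometric by simp
qed

section \<open>Rigidity of closed 1-forms whose image under the twisted structure is closed\<close>

context
  fixes A :: "real ^ 4 \<Rightarrow> real ^ 4 \<Rightarrow> complex" and r :: real
  assumes linear_A: "\<And>x. linear (A x)"
    and diff_A: "\<And>v x. (\<lambda>y. A y v) differentiable (at x)"
    and diff_B: "\<And>v x. (\<lambda>y. A y (twisted_J r y v)) differentiable (at x)"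
    and bounded_A: "\<And>v. bounded (range (\<lambda>x. A x v))"
    and closed_A: "\<And>x v w. frechet_derivative (\<lambda>y. A y w) (at x) v = frechet_derivative (\<lambda>y. A y v) (at x) w"
    and closed_B: "\<And>x v w. frechet_derivative (\<lambda>y. A y (twisted_J r y w)) (at x) v =
      frechet_derivative (\<lambda>y. A y (twisted_J r y v)) (at x) w"
begin

lemma expand_components: "A x v = of_real (v $ 1) * A x (axis 1 1) + of_real (v $ 2) * A x (axis 2 1) +
    of_real (v $ 3) * A x (axis 3 1) + of_real (v $ 4) * A x (axis 4 1)"
proof -
  have "v = v $ 1 *\<^sub>R axis 1 1 + v $ 2 *\<^sub>R axis 2 1 + v $ 3 *\<^sub>R axis 3 1 + v $ 4 *\<^sub>R axis 4 1"
    by (simp add: vec4_eq_iff axis_def)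
  then have "A x v = A x (v $ 1 *\<^sub>R axis 1 1 + v $ 2 *\<^sub>R axis 2 1 + v $ 3 *\<^sub>R axis 3 1 + v $ 4 *\<^sub>R axis 4 1)"
    by simp
  then show ?thesis
    unfolding linear_add[OF linear_A] linear_scale[OF linear_A] by (simp add: scaleR_conv_of_real)
qed

lemmas twisted_constant_along_plane = constant_along_plane[of A "twisted_J r",
    OF linear_A twisted_J_twisted_J diff_A diff_B bounded_A closed_A closed_B]
lemmas twisted_constant_along_plane_J = constant_along_plane_J[of A "twisted_J r",
    OF linear_A twisted_J_twisted_J diff_A diff_B bounded_A closed_A closed_B]

text \<open>The structure depends on \<open>x $ 3\<close> only, so it is constant on planes parallel
  to the first two axes; these are spanned by \<partial>_2 and J \<partial>_2.\<close>

lemma constant_12: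
  assumes "x $ 3 = y $ 3" "x $ 4 = y $ 4"
  shows "A y (axis 1 1) = A x (axis 1 1)" "A y (axis 2 1) = A x (axis 2 1)"
proof -
  let ?d = "axis 2 1 :: real ^ 4" and ?s = "r * sin (x $ 3)"
  have e: "twisted_J r x ?d = vec4 (- 1) (- ?s) 0 0"
    by (simp add: twisted_J_def Let_def vec4_eq_iff axis_def)
  have J: "twisted_J r (x + s *\<^sub>R ?d + t *\<^sub>R twisted_J r x ?d) ?d = twisted_J r x ?d" for s t
    unfolding e by (simp add: twisted_J_def axis_def)
  \<comment> \<open>Coordinates of \<open>y\<close> in the plane: J \<partial>_2 = - \<partial>_1 -
    s \<partial>_2, so the first component fixes \<open>t\<close> and the second then fixes
    \<open>s\<close>.\<close>
  define t where "t = x $ 1 - y $ 1"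
  define s where "s = y $ 2 - x $ 2 + t * ?s"
  have y: "y = x + s *\<^sub>R ?d + t *\<^sub>R twisted_J r x ?d"
    unfolding e using assms by (simp add: vec4_eq_iff axis_def s_def t_def)
  show 2: "A y ?d = A x ?d" unfolding y by (rule twisted_constant_along_plane[OF J])
  have "A y (twisted_J r x ?d) = A x (twisted_J r x ?d)" unfolding y by (rule twisted_constant_along_plane_J[OF J])
  then show "A y (axis 1 1) = A x (axis 1 1)"
    unfolding expand_components[of y "twisted_J r x ?d"] expand_components[of x "twisted_J r x ?d"] 2 by (simp add: e)
qed

text \<open>Although the first block of the structure varies along these planes, J \<partial>_3 =
  \<partial>_4 at every point, and only this enters \<open>constant_along_plane\<close>.\<close>

lemma constant_34:
  assumes "x $ 1 = y $ 1" "x $ 2 = y $ 2"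
  shows "A y (axis 3 1) = A x (axis 3 1)" "A y (axis 4 1) = A x (axis 4 1)"
proof -
  let ?d = "axis 3 1 :: real ^ 4"
  have e: "twisted_J r x ?d = axis 4 1" for x
    by (simp add: twisted_J_def Let_def vec4_eq_iff axis_def)
  have y: "y = x + (y $ 3 - x $ 3) *\<^sub>R ?d + (y $ 4 - x $ 4) *\<^sub>R twisted_J r x ?d"
    unfolding e using assms by (simp add: vec4_eq_iff axis_def)
  show "A y ?d = A x ?d" by (subst y, rule twisted_constant_along_plane) (simp only: e)
  have "A y (twisted_J r x ?d) = A x (twisted_J r x ?d)" by (subst (1) y, rule twisted_constant_along_plane_J) (simp only: e)
  then show "A y (axis 4 1) = A x (axis 4 1)" by (simp add: e)
qed

text \<open>The mixed derivative is constant, being invariant under translations in all directions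
  because of the two expressions for it; as \<open>A\<close> is bounded it vanishes.\<close>

lemma mixed_derivative:
  assumes "i = 1 \<or> i = 2" "j = 3 \<or> j = 4"
  shows "frechet_derivative (\<lambda>y. A y (axis i 1)) (at x) (axis j 1) = 0"
proof -
  have c_i: "A y (axis i 1) = A x (axis i 1)" if "x $ 3 = y $ 3" "x $ 4 = y $ 4" for x y
    using constant_12[OF that] assms(1) by auto
  have c_j: "A y (axis j 1) = A x (axis j 1)" if "x $ 1 = y $ 1" "x $ 2 = y $ 2" for x y
    using constant_34[OF that] assms(2) by auto
  have "frechet_derivative (\<lambda>y. A y (axis i 1)) (at x) (axis j 1) =
      frechet_derivative (\<lambda>y. A y (axis j 1)) (at 0) (axis i 1)" for x
  proof -
    \<comment> \<open>The derivative of the i-th coefficient ignores the first two coordinates of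
      the point, that of the j-th the last two. Passing through \<open>z\<close> exploits one after
      the other.\<close>
    define z where "z = vec4 0 0 (x $ 3) (x $ 4)"
    have "frechet_derivative (\<lambda>y. A y (axis i 1)) (at x) (axis j 1) =
        frechet_derivative (\<lambda>y. A y (axis i 1)) (at z) (axis j 1)"
      by (intro frechet_derivative_eq_along_lines diff_A c_i) (simp_all add: z_def)
    also have "\<dots> = frechet_derivative (\<lambda>y. A y (axis j 1)) (at z) (axis i 1)"
      by (rule closed_A)
    also have "\<dots> = frechet_derivative (\<lambda>y. A y (axis j 1)) (at 0) (axis i 1)"
      by (intro frechet_derivative_eq_along_lines diff_A c_j) (simp_all add: z_def)
    finally show ?thesis .
  qed
  with bounded_constant_slope[OF diff_A bounded_A] show ?thesis by metis
qed

text \<open>All partial derivatives of the coefficients vanish: within a block by constancy on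
  planes, across blocks by \<open>mixed_derivative\<close> and closedness. The point
  \<open>x\<close> is then reached from 0 along the axes.\<close>

lemma constant_components: "A x v = A 0 v"
proof -
  have "frechet_derivative (\<lambda>y. A y (axis i 1)) (at x) (axis j 1) = 0" for i j x
  proof -
    have z: "frechet_derivative (\<lambda>y. A y (axis i 1)) (at x) (axis j 1) = 0"
      if "\<And>t. A (x + t *\<^sub>R axis j 1) (axis i 1) = A x (axis i 1)"
      using frechet_derivative_eq_along_lines[OF diff_A, of "\<lambda>y. A x (axis i 1)" x x "axis j 1" "axis i 1"] that
      by simp
    consider "(i = 1 \<or> i = 2) \<and> (j = 1 \<or> j = 2)" | "(i = 3 \<or> i = 4) \<and> (j = 3 \<or> j = 4)" |
      "(i = 1 \<or> i = 2) \<and> (j = 3 \<or> j = 4)" | "(i = 3 \<or> i = 4) \<and> (j = 1 \<or> j = 2)"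
      using exhaust_4[of i] exhaust_4[of j] by blast
    then show ?thesis
    proof cases
      case 1
      have "A (x + t *\<^sub>R axis j 1) (axis i 1) = A x (axis i 1)" for t
        using 1 constant_12[of x "x + t *\<^sub>R axis j 1"] by (auto simp: axis_def)
      then show ?thesis by (rule z)
    next
      case 2
      have "A (x + t *\<^sub>R axis j 1) (axis i 1) = A x (axis i 1)" for t
        using 2 constant_34[of x "x + t *\<^sub>R axis j 1"] by (auto simp: axis_def)
      then show ?thesis by (rule z)
    next
      case 3
      then show ?thesis by (simp add: mixed_derivative)
    next
      case 4
      then show ?thesis using mixed_derivative[of j i x] closed_A by metis
    qed
  qed
  note z = this
  have step: "A (x + t *\<^sub>R axis j 1) (axis i 1) = A x (axis i 1)" for x t i j
    by (rule zero_derivative_along_line[OF diff_A z])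
  have const: "A x (axis i 1) = A 0 (axis i 1)" for i
  proof -
    have "x = 0 + x $ 1 *\<^sub>R axis 1 1 + x $ 2 *\<^sub>R axis 2 1 + x $ 3 *\<^sub>R axis 3 1 + x $ 4 *\<^sub>R axis 4 1"
      by (simp add: vec4_eq_iff axis_def)
    then have "A x (axis i 1) =
        A (0 + x $ 1 *\<^sub>R axis 1 1 + x $ 2 *\<^sub>R axis 2 1 + x $ 3 *\<^sub>R axis 3 1 + x $ 4 *\<^sub>R axis 4 1) (axis i 1)"
      by simp
    then show ?thesis unfolding step .
  qed
  show ?thesis unfolding expand_components[of x v] expand_components[of 0 v] const[of 1] const[of 2] const[of 3] const[of 4] ..
qed

text \<open>Only here the twist matters: \<open>A \<circ> J\<close> must be constant in the direction of the circle.\<close>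

lemma twisted_components_eq_0:
  assumes "r \<noteq> 0"
  shows "A 0 (axis 1 1) = 0" "A 0 (axis 2 1) = 0"
proof -
  let ?B = "\<lambda>v x. A x (twisted_J r x v)" and ?e = "axis 3 1 :: real ^ 4"
  have "twisted_J r y ?e = axis 4 1" for y
    by (simp add: twisted_J_def Let_def vec4_eq_iff axis_def)
  \<comment> \<open>The component of A \<circ> J along \<partial>_3 is a constant, so closedness
    makes every other component constant in that direction.\<close>
  then have "?B ?e = (\<lambda>y. A 0 (axis 4 1))" using constant_components by metis
  then have "frechet_derivative (?B v) (at x) ?e = 0" for v x
    by (subst closed_B) simp
  \<comment> \<open>The points 0 and (pi / 2) \<partial>_3 are compared: there s equals 0 and
    \<open>r\<close> respectively.\<close>
  from zero_derivative_along_line[OF diff_B this]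
  have B: "?B v (0 + (pi / 2) *\<^sub>R ?e) = ?B v 0" for v .
  have B: "A 0 (twisted_J r ((pi / 2) *\<^sub>R ?e) v) = A 0 (twisted_J r 0 v)" for v
    using B[of v] constant_components by (metis add_0)
  have J: "twisted_J r 0 (axis 2 1) = vec4 (- 1) 0 0 0"
    "twisted_J r ((pi / 2) *\<^sub>R ?e) (axis 2 1) = vec4 (- 1) (- r) 0 0"
    "twisted_J r 0 (axis 1 1) = vec4 0 1 0 0"
    "twisted_J r ((pi / 2) *\<^sub>R ?e) (axis 1 1) = vec4 r (1 + r\<^sup>2) 0 0"
    by (simp_all add: twisted_J_def Let_def vec4_eq_iff axis_def)
  \<comment> \<open>With a_i the coefficients, \<partial>_2 gives - a_1 - r a_2 = - a_1. Then
    \<partial>_1 gives r a_1 + (1 + r^2) a_2 = a_2.\<close>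
  show 2: "A 0 (axis 2 1) = 0"
    using B[of "axis 2 1"] assms unfolding J expand_components[of 0 "vec4 _ _ _ _"] by simp
  show "A 0 (axis 1 1) = 0"
    using B[of "axis 1 1"] assms unfolding J expand_components[of 0 "vec4 _ _ _ _"] 2 by simp
qed

lemma twisted_closed_form:
  assumes "r \<noteq> 0"
  shows "A x v = of_real (v $ 3) * A 0 (axis 3 1) + of_real (v $ 4) * A 0 (axis 4 1)"
  using twisted_components_eq_0[OF assms] expand_components[of 0 v] by (simp add: constant_components[of x v])

end

section \<open>The symplectic torus\<close>

lemma tensor_field_torus_tensor_2:
  fixes b :: "real ^ 'n \<Rightarrow> real ^ 'n \<Rightarrow> real ^ 'n \<Rightarrow> 'b::real_normed_vector"
  assumes "\<And>x v. linear (\<lambda>u. b x u v)" "\<And>x u. linear (b x u)"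
    and "\<And>S u v. smooth_on S (\<lambda>x. b x u v)"
    and "\<And>x y. torus_map x = torus_map y \<Longrightarrow> b x = b y"
  shows "tensor_field torus_atlas 2 (torus_tensor 2 (\<lambda>x vs. b x (vs ! 0) (vs ! 1)))"
proof (rule tensor_field_torus_tensor)
  fix x and vs :: "(real ^ 'n) list" and i :: nat assume "length vs = 2" "i < 2"
  then have "i = 0 \<or> i = 1" "length vs = 2" by auto
  then show "linear (\<lambda>v. b x (vs[i := v] ! 0) (vs[i := v] ! 1))"
    using assms(1)[of x "vs ! 1"] assms(2)[of x "vs ! 0"] by auto
next
  show "(\<lambda>vs. b x (vs ! 0) (vs ! 1)) = (\<lambda>vs. b y (vs ! 0) (vs ! 1))"
    if "torus_map x = torus_map y" for x y
    using assms(4)[OF that] by simp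
qed (rule assms(3))

definition omega0 :: "real ^ 4 \<Rightarrow> real ^ 4 \<Rightarrow> real" where
  "omega0 u v = u $ 1 * v $ 2 - u $ 2 * v $ 1 + u $ 3 * v $ 4 - u $ 4 * v $ 3"

definition torus_omega :: "(complex ^ 4, real ^ 4, real) tensor" where
  "torus_omega = torus_tensor 2 (\<lambda>x vs. omega0 (vs ! 0) (vs ! 1))"

lemma omega0_linear: "linear (\<lambda>u. omega0 u v)" "linear (omega0 u)"
  by (rule linearI; simp add: omega0_def algebra_simps)+

lemma symplectic_form_torus_omega: "symplectic_form torus_atlas torus_omega"
  unfolding symplectic_form_def
proof (intro conjI ballI allI impI)
  have "tensor_field torus_atlas 2 torus_omega"
    unfolding torus_omega_def
    by (intro tensor_field_torus_tensor_2) (auto simp: omega0_linear smooth_on_const)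
  moreover have "alternating 2 (torus_omega c x)" for c x
    unfolding alternating_def
  proof (intro allI impI)
    fix vs :: "(real ^ 4) list" and i j :: nat
    assume "length vs = 2 \<and> i < j \<and> j < 2 \<and> vs ! i = vs ! j"
    moreover then have "i = 0" "j = 1" by auto
    ultimately show "torus_omega c x vs = 0" by (auto simp: torus_omega_def torus_tensor_def omega0_def)
  qed
  ultimately show "torus_omega \<in> forms torus_atlas 2" by (simp add: forms_def)
  show "ext_deriv torus_atlas torus_omega = (\<lambda>c x vs. 0)"
    by (rule ext_deriv_torus_locally_constant) (auto simp: torus_omega_def torus_tensor_chart)
next
  fix c :: "(complex ^ 4, real ^ 4) chart" and x u
  assume "c \<in> torus_atlas" "x \<in> coords c" "\<forall>v. torus_omega c x [u, v] = 0"
  then have "omega0 u v = 0" for v by (auto simp: torus_omega_def torus_tensor_def)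
  from this[of "vec4 0 1 0 0"] this[of "vec4 1 0 0 0"] this[of "vec4 0 0 0 1"] this[of "vec4 0 0 1 0"]
  show "u = 0" by (simp add: omega0_def vec4_eq_iff)
qed

text \<open>The Euclidean product after undoing the shear, which makes symmetry and positivity of
  the metric visible.\<close>

lemma omega0_twisted_J:
  "omega0 u (twisted_J r x v) = u $ 1 * v $ 1 +
    (u $ 2 - r * sin (x $ 3) * u $ 1) * (v $ 2 - r * sin (x $ 3) * v $ 1) + u $ 3 * v $ 3 + u $ 4 * v $ 4"
  by (simp add: omega0_def twisted_J_def Let_def algebra_simps power2_eq_square)

lemma twisted_J_periodic:
  "torus_map x = torus_map y \<Longrightarrow> twisted_J r x = twisted_J r y"
  using torus_map_sin[of x y 3] by (simp add: twisted_J_def fun_eq_iff)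

lemma compatible_twisted_J: "compatible torus_atlas torus_omega (\<lambda>c. twisted_J r)"
  unfolding compatible_def
proof (intro conjI ballI allI)
  show "almost_complex torus_atlas (\<lambda>c. twisted_J r)"
    unfolding almost_complex_def
  proof (intro conjI ballI allI)
    fix c d :: "(complex ^ 4, real ^ 4) chart" and x v
    assume "c \<in> torus_atlas" "d \<in> torus_atlas" and x: "x \<in> overlap c d"
    then obtain p q where c: "c = torus_chart p" "d = torus_chart q" by (auto simp: torus_atlas_def)
    obtain y where y: "x \<in> ball p 1" "y \<in> ball q 1" "torus_map x = torus_map y"
      using x unfolding c overlap_torus_chart by auto
    have "frechet_derivative (transition c d) (at x) = (\<lambda>v. v)"
      using frechet_derivative_at[OF has_derivative_transition_torus_chart] x c by metis
    then show "frechet_derivative (transition c d) (at x) (twisted_J r x v) =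
        twisted_J r (transition c d x) (frechet_derivative (transition c d) (at x) v)"
      using twisted_J_periodic[OF y(3)] unfolding c transition_torus_chart[OF y] by simp
  qed (auto simp: linear_twisted_J twisted_J_twisted_J smooth_on_twisted_J)
next
  fix c :: "(complex ^ 4, real ^ 4) chart" and x u v
  assume "c \<in> torus_atlas" "x \<in> coords c"
  then show "torus_omega c x [twisted_J r x u, twisted_J r x v] = torus_omega c x [u, v]"
    by (simp add: torus_omega_def torus_tensor_def omega0_twisted_J)
      (simp add: omega0_def twisted_J_def Let_def algebra_simps power2_eq_square)
next
  have g: "(\<lambda>c x vs. if length vs = 2 then torus_omega c x [vs ! 0, twisted_J r x (vs ! 1)] else 0) =
      torus_tensor 2 (\<lambda>x vs. omega0 (vs ! 0) (twisted_J r x (vs ! 1)))"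
    by (auto simp: fun_eq_iff torus_omega_def torus_tensor_def)
  show "riemannian_metric torus_atlas
      (\<lambda>c x vs. if length vs = 2 then torus_omega c x [vs ! 0, twisted_J r x (vs ! 1)] else 0)"
    unfolding g riemannian_metric_def
  proof (intro conjI ballI allI impI)
    show "tensor_field torus_atlas 2 (torus_tensor 2 (\<lambda>x vs. omega0 (vs ! 0) (twisted_J r x (vs ! 1))))"
    proof (rule tensor_field_torus_tensor_2)
      show "linear (\<lambda>u. omega0 u (twisted_J r x v))" for x v by (rule omega0_linear)
      show "linear (\<lambda>v. omega0 u (twisted_J r x v))" for x u
        using linear_compose[OF linear_twisted_J omega0_linear(2)] by (simp add: comp_def)
      show "smooth_on S (\<lambda>x. omega0 u (twisted_J r x v))" for S u v
      proof -
        have "omega0 u (twisted_J r x v) =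
            ((1 + r\<^sup>2 / 2) * (u $ 1 * v $ 1) + u $ 2 * v $ 2 + u $ 3 * v $ 3 + u $ 4 * v $ 4) +
            sin (x $ 3) *\<^sub>R (- r * (u $ 1 * v $ 2 + u $ 2 * v $ 1)) +
            cos (2 * x $ 3) *\<^sub>R (- r\<^sup>2 / 2 * (u $ 1 * v $ 1))" for x
          unfolding omega0_twisted_J by (simp add: cos_double_sin field_simps power2_eq_square)
        then show ?thesis by (simp only: smooth_on_trigonometric)
      qed
      show "(\<lambda>u v. omega0 u (twisted_J r x v)) = (\<lambda>u v. omega0 u (twisted_J r y v))"
        if "torus_map x = torus_map y" for x y
        using twisted_J_periodic[OF that] by simp
    qed
  next
    fix c :: "(complex ^ 4, real ^ 4) chart" and x u v
    assume "c \<in> torus_atlas" "x \<in> coords c"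
    then show "torus_tensor 2 (\<lambda>x vs. omega0 (vs ! 0) (twisted_J r x (vs ! 1))) c x [u, v] =
        torus_tensor 2 (\<lambda>x vs. omega0 (vs ! 0) (twisted_J r x (vs ! 1))) c x [v, u]"
      by (simp add: torus_tensor_def omega0_twisted_J mult.commute)
  next
    fix c :: "(complex ^ 4, real ^ 4) chart" and x u
    assume cx: "c \<in> torus_atlas" "x \<in> coords c" and u: "u \<noteq> (0 :: real ^ 4)"
    define w where "w = u $ 2 - r * sin (x $ 3) * u $ 1"
    have "u $ 1 \<noteq> 0 \<or> w \<noteq> 0 \<or> u $ 3 \<noteq> 0 \<or> u $ 4 \<noteq> 0"
      using u unfolding vec4_eq_iff w_def by auto
    then have "u $ 1 * u $ 1 + w * w + u $ 3 * u $ 3 + u $ 4 * u $ 4 > 0"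
      by (smt (verit) mult_pos_pos mult_neg_neg zero_le_square)
    then show "torus_tensor 2 (\<lambda>x vs. omega0 (vs ! 0) (twisted_J r x (vs ! 1))) c x [u, u] > 0"
      using cx by (simp add: torus_tensor_def omega0_twisted_J w_def)
  qed
qed

section \<open>Comparison of the dimensions\<close>

definition torus_dx :: "'n \<Rightarrow> (complex ^ 'n, real ^ 'n, complex) tensor" where
  "torus_dx k = torus_tensor 1 (\<lambda>x vs. of_real (vs ! 0 $ k))"

lemma torus_dx_form: "torus_dx k \<in> complex_forms torus_atlas 1"
proof -
  have "linear (\<lambda>v :: real ^ 'a. complex_of_real (v $ k))"
    by (rule linearI)
      (simp, simp, simp only: scaleR_conv_of_real)
  then have "tensor_field torus_atlas 1 (torus_dx k)"
    unfolding torus_dx_def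
    by (intro tensor_field_torus_tensor) (auto simp: smooth_on_const)
  then show ?thesis by (simp add: forms_def alternating_def)
qed

lemma torus_lift_dx: "torus_lift (torus_dx k) x v = of_real (v $ k)"
  by (simp add: torus_lift_def torus_dx_def torus_tensor_chart)

text \<open>Evaluation at a single point on the coordinate vectors gives the Kronecker delta, which
  separates the forms and isolates each coefficient.\<close>

lemma independent_torus_dx:
  "\<not> module.dependent scale_form (range (torus_dx :: 'n \<Rightarrow> (complex ^ 'n, real ^ 'n, complex) tensor))"
  "inj (torus_dx :: 'n \<Rightarrow> (complex ^ 'n, real ^ 'n, complex) tensor)"
proof -
  interpret vector_space "scale_form :: complex \<Rightarrow> (complex ^ 'n, real ^ 'n, complex) tensor \<Rightarrow> _"
    by (rule vector_space_scale_form)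
  have ev: "torus_dx k (torus_chart 0) 0 [axis j 1] = (if j = k then 1 else 0)" for j k :: 'n
    by (simp add: torus_dx_def torus_tensor_chart axis_def)
  show inj: "inj (torus_dx :: 'n \<Rightarrow> _)"
    by (rule injI) (metis ev zero_neq_one)
  show "independent (range (torus_dx :: 'n \<Rightarrow> _))"
  proof
    assume "dependent (range (torus_dx :: 'n \<Rightarrow> _))"
    then obtain u j where u: "(\<Sum>v\<in>range torus_dx. scale_form (u v) v) = 0"
      and j: "u (torus_dx (j :: 'n)) \<noteq> 0"
      by (auto simp: dependent_finite)
    have "0 = (\<Sum>k\<in>UNIV. scale_form (u (torus_dx k)) (torus_dx k)) (torus_chart 0) 0 [axis j 1]"
      using u by (simp add: sum.reindex[OF inj])
    also have "\<dots> = (\<Sum>k\<in>UNIV. u (torus_dx k) * (if j = k then 1 else 0))"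
      by (simp only: sum_fun_apply scale_form_def ev)
    also have "\<dots> = u (torus_dx j)"
      by (simp add: if_distrib[of "\<lambda>z. _ * z"] cong: if_cong)
    finally show False using j by simp
  qed
qed

text \<open>In the finite case a basis of \<open>V\<close> is finite and spans \<open>B\<close>, so
  the exchange bound applies; otherwise the value is infinite.\<close>

lemma complex_dim_lower_bound:
  assumes "finite B" "B \<subseteq> V" "\<not> module.dependent scale_form B"
  shows "enat (card B) \<le> complex_dim V"
proof (cases "\<exists>B. finite B \<and> V \<subseteq> module.span scale_form B")
  case True
  interpret vector_space "scale_form :: complex \<Rightarrow> ('a, 'b, complex) tensor \<Rightarrow> _"
    by (rule vector_space_scale_form)
  obtain W where W: "finite W" "V \<subseteq> span W" using True by blast
  obtain C where C: "C \<subseteq> V" "independent C" "V \<subseteq> span C" "card C = dim V"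
    by (rule basis_exists)
  have "finite C" using independent_span_bound[OF W(1) C(2)] C(1) W(2) by blast
  then have "card B \<le> dim V"
    using independent_span_bound[of C B] assms(2,3) C by auto
  then show ?thesis using True by (simp add: complex_dim_def)
qed (auto simp: complex_dim_def)

lemma complex_dim_upper_bound:
  assumes "finite B" "V \<subseteq> module.span scale_form B"
  shows "complex_dim V \<le> enat (card B)"
proof -
  interpret vector_space "scale_form :: complex \<Rightarrow> ('a, 'b, complex) tensor \<Rightarrow> _"
    by (rule vector_space_scale_form)
  show ?thesis
    using dim_le_card[OF assms(2,1)] assms by (auto simp: complex_dim_def)
qed

text \<open>Here point and vector vary together. Expanding the vector in coordinates leaves products
  of differentiable functions of the point.\<close>

lemma torus_lift_twisted_J_differentiable:
  assumes "tensor_field torus_atlas 1 \<alpha>"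
  shows "(\<lambda>y. torus_lift \<alpha> y (twisted_J r y v)) differentiable (at x)"
proof -
  have "torus_lift \<alpha> y w = (\<Sum>k\<in>UNIV. (w $ k) *\<^sub>R torus_lift \<alpha> y (axis k 1))" for y w
  proof -
    have "w = (\<Sum>k\<in>UNIV. (w $ k) *\<^sub>R axis k 1)"
      by (simp add: vec_eq_iff axis_def if_distrib[of "\<lambda>z. _ * z"] cong: if_cong)
    then have "torus_lift \<alpha> y w = torus_lift \<alpha> y (\<Sum>k\<in>UNIV. (w $ k) *\<^sub>R axis k 1)" by simp
    also have "\<dots> = (\<Sum>k\<in>UNIV. (w $ k) *\<^sub>R torus_lift \<alpha> y (axis k 1))"
      by (simp only: linear_sum[OF torus_lift_linear[OF assms]] linear_scale[OF torus_lift_linear[OF assms]])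
    finally show ?thesis .
  qed
  then have e: "(\<lambda>y. torus_lift \<alpha> y (twisted_J r y v)) =
      (\<lambda>y. \<Sum>k\<in>UNIV. (twisted_J r y v $ k) *\<^sub>R torus_lift \<alpha> y (axis k 1))" by (rule ext)
  have "(\<lambda>y. twisted_J r y v) differentiable (at x)"
    by (rule smooth_on_imp_differentiable[OF smooth_on_twisted_J UNIV_I])
  then have "(\<lambda>y. twisted_J r y v $ k) differentiable (at x)" for k
    unfolding differentiable_def using bounded_linear.has_derivative[OF bounded_linear_vec_nth] by blast
  with torus_lift_differentiable[OF assms]
  have "(\<lambda>y. (twisted_J r y v $ k) *\<^sub>R torus_lift \<alpha> y (axis k 1)) differentiable (at x)" for k
    unfolding differentiable_def using has_derivative_scaleR by blast
  then show ?thesis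
    unfolding e by (intro differentiable_sum) auto
qed

lemma h1_standard_J: "4 \<le> h1_d_dc torus_atlas (\<lambda>c. twisted_J 0)"
proof -
  have "range torus_dx \<subseteq> {\<alpha> \<in> complex_forms torus_atlas 1.
      ext_deriv torus_atlas \<alpha> = (\<lambda>c x vs. 0) \<and> dc torus_atlas (\<lambda>c. twisted_J 0) 1 \<alpha> = (\<lambda>c x vs. 0)}"
  proof (intro subsetI CollectI)
    fix \<alpha> :: "(complex ^ 4, real ^ 4, complex) tensor" assume "\<alpha> \<in> range torus_dx"
    then obtain k where \<alpha>: "\<alpha> = torus_dx k" by auto
    have "ext_deriv torus_atlas (torus_dx k) = (\<lambda>c x vs. 0)"
      by (rule ext_deriv_torus_locally_constant) (auto simp: torus_dx_def torus_tensor_chart)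
    \<comment> \<open>For r = 0 the structure is the same at all points; evaluating it at 0 exhibits
      constant coefficients.\<close>
    moreover have "torus_lift (torus_dx k) x (twisted_J 0 x v) = of_real (twisted_J 0 0 v $ k)" for x v
      by (simp add: torus_lift_dx twisted_J_def)
    then have "dc torus_atlas (\<lambda>c. twisted_J 0) 1 (torus_dx k) = (\<lambda>c x vs. 0)"
      by (subst dc_torus_eq_0_iff[OF torus_dx_form linear_twisted_J twisted_J_twisted_J])
        simp_all
    ultimately show "\<alpha> \<in> complex_forms torus_atlas 1 \<and> ext_deriv torus_atlas \<alpha> = (\<lambda>c x vs. 0) \<and>
        dc torus_atlas (\<lambda>c. twisted_J 0) 1 \<alpha> = (\<lambda>c x vs. 0)"
      unfolding \<alpha> using torus_dx_form by blast
  qed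
  from complex_dim_lower_bound[OF _ this independent_torus_dx(1)]
  have "enat (card (range (torus_dx :: 4 \<Rightarrow> _))) \<le> h1_d_dc torus_atlas (\<lambda>c. twisted_J 0)"
    by (simp add: h1_d_dc_def)
  also have "card (range (torus_dx :: 4 \<Rightarrow> _)) = 4"
    by (simp add: card_image[OF independent_torus_dx(2)])
  finally show ?thesis by (simp add: numeral_eq_enat)
qed

text \<open>By \<open>twisted_closed_form\<close> such a form is a combination of dx_3 and dx_4 with
  constant coefficients.\<close>

lemma h1_twisted_J:
  assumes "r \<noteq> 0"
  shows "h1_d_dc torus_atlas (\<lambda>c. twisted_J r) \<le> 2"
proof -
  interpret vector_space "scale_form :: complex \<Rightarrow> (complex ^ 4, real ^ 4, complex) tensor \<Rightarrow> _"
    by (rule vector_space_scale_form)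
  let ?B = "{torus_dx 3, torus_dx 4 :: (complex ^ 4, real ^ 4, complex) tensor}"
  have "{\<alpha> \<in> complex_forms torus_atlas 1. ext_deriv torus_atlas \<alpha> = (\<lambda>c x vs. 0) \<and>
      dc torus_atlas (\<lambda>c. twisted_J r) 1 \<alpha> = (\<lambda>c x vs. 0)} \<subseteq> span ?B"
  proof
    fix \<alpha> assume "\<alpha> \<in> {\<alpha> \<in> complex_forms torus_atlas 1. ext_deriv torus_atlas \<alpha> = (\<lambda>c x vs. 0) \<and>
      dc torus_atlas (\<lambda>c. twisted_J r) 1 \<alpha> = (\<lambda>c x vs. 0)}"
    then have \<alpha>: "\<alpha> \<in> complex_forms torus_atlas 1" and d: "ext_deriv torus_atlas \<alpha> = (\<lambda>c x vs. 0)"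
      and dc: "dc torus_atlas (\<lambda>c. twisted_J r) 1 \<alpha> = (\<lambda>c x vs. 0)" by auto
    have tf: "tensor_field torus_atlas 1 \<alpha>" using \<alpha> by (simp add: forms_def)
    have "represents_1_form (torus_lift \<alpha>) \<alpha>"
      unfolding represents_1_form_def using torus_lift_chart[OF tf] by blast
    note closed_A = ext_deriv_torus_1_form_eq_0_iff[OF this, THEN iffD1, OF d, rule_format]
    note diff_B = torus_lift_twisted_J_differentiable[OF tf]
    note closed_B = dc_torus_eq_0_iff[OF \<alpha> linear_twisted_J twisted_J_twisted_J diff_B,
        THEN iffD1, OF dc, rule_format]
    note A = twisted_closed_form[OF torus_lift_linear[OF tf] torus_lift_differentiable[OF tf] diff_B
        torus_lift_bounded[OF tf] closed_A closed_B assms]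
    have "\<alpha> c x vs = scale_form (torus_lift \<alpha> 0 (axis 3 1)) (torus_dx 3) c x vs +
        scale_form (torus_lift \<alpha> 0 (axis 4 1)) (torus_dx 4) c x vs" for c x vs
    proof (cases "c \<in> torus_atlas \<and> x \<in> coords c \<and> length vs = 1")
      case True
      then obtain p where p: "c = torus_chart p" "x \<in> ball p 1" using torus_atlas_cases by metis
      from True obtain v where "vs = [v]" by (auto simp: length_Suc_conv)
      then show ?thesis
        using p A[of x v] by (simp add: torus_lift_chart[OF tf] scale_form_def torus_dx_def torus_tensor_chart)
    next
      \<comment> \<open>Outside the charts, or on lists of another length, both sides are 0 by the
        convention for tensor fields.\<close>
      case False
      then have "\<alpha> c x vs = 0" using tf unfolding tensor_field_def by blast
      with False show ?thesis by (auto simp: scale_form_def torus_dx_def torus_tensor_def)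
    qed
    then have "\<alpha> = scale_form (torus_lift \<alpha> 0 (axis 3 1)) (torus_dx 3) +
        scale_form (torus_lift \<alpha> 0 (axis 4 1)) (torus_dx 4)" by (simp add: fun_eq_iff)
    moreover have "\<dots> \<in> span ?B" by (intro span_add span_scale span_base) auto
    ultimately show "\<alpha> \<in> span ?B" by metis
  qed
  from complex_dim_upper_bound[OF _ this]
  have "h1_d_dc torus_atlas (\<lambda>c. twisted_J r) \<le> enat (card ?B)" by (simp add: h1_d_dc_def)
  also have "\<dots> \<le> 2" by (simp add: numeral_eq_enat card_insert_if)
  finally show ?thesis .
qed

theorem proposition5p8:
  shows "\<exists>(X :: point topology) (A :: (point, real ^ 4) chart set) \<omega> J\<^sub>1 J\<^sub>2.
           smooth_manifold X A \<and> compact_space X \<and> symplectic_form A \<omega> \<and>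
           compatible A \<omega> J\<^sub>1 \<and> compatible A \<omega> J\<^sub>2 \<and>
           h1_d_dc A J\<^sub>1 \<noteq> h1_d_dc A J\<^sub>2"
proof -
  have "h1_d_dc torus_atlas (\<lambda>c. twisted_J 1) < h1_d_dc torus_atlas (\<lambda>c. twisted_J 0)"
  proof -
    have "h1_d_dc torus_atlas (\<lambda>c. twisted_J 1) \<le> 2" by (rule h1_twisted_J) simp
    also have "(2 :: enat) < 4" by simp
    also have "4 \<le> h1_d_dc torus_atlas (\<lambda>c. twisted_J 0)" by (rule h1_standard_J)
    finally show ?thesis .
  qed
  then show ?thesis
    using smooth_manifold_torus compact_space_torus symplectic_form_torus_omega
      compatible_twisted_J[of 0] compatible_twisted_J[of 1]
    by (intro exI[of _ torus] exI[of _ torus_atlas] exI[of _ torus_omega]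
        exI[of _ "\<lambda>c. twisted_J 0"] exI[of _ "\<lambda>c. twisted_J 1"]) auto
qed

end
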